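(* Let $p\ge1$, $m=2p$, $j=\mathrm{diag}(I_p,-I_p)$. A $p\times p$ matrix function $\varphi$ is the Weyl function of some system determined by parameter matrices $A,S_0,\Pi_0$ with $S_0>0$ (see context) if and only if it admits a representation $$\varphi(\lambda)=-i\widetilde\Phi^*(\theta-\lambda I_n)^{-1}\widetilde\Psi,\qquad \theta-\theta^*=i(\widetilde\Phi\widetilde\Phi^*+\widetilde\Psi\widetilde\Psi^* ),$$ for some $n$, some $n\times n$ matrix $\theta$ and $n\times p$ matrices $\widetilde\Phi,\widetilde\Psi$, such that $\det(\theta-i\widetilde\Psi\widetilde\Psi^* )\neq0$. In that case $\varphi$ is the Weyl function of the system (which has $C_k>0$) determined by the parameter matrices $S_0=I_n$, $A=\theta-i\widetilde\Psi\widetilde\Psi^*$, $\Pi_0=[\widetilde\Phi\ \ \widetilde\Psi]$.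
   Context: Parameter matrices: an $n\times n$ matrix $A$ with $\det A\neq0$, an $n\times n$ matrix $S_0=S_0^*$ and an $n\times m$ matrix $\Pi_0$ with $AS_0-S_0A^*=i\Pi_0j\Pi_0^*$. They determine $\Pi_{k+1}=\Pi_k+iA^{-1}\Pi_kj$, $S_{k+1}=S_k+A^{-1}S_k(A^* )^{-1}+A^{-1}\Pi_k\Pi_k^*(A^* )^{-1}$ and $C_k=I_m+\Pi_k^*S_k^{-1}\Pi_k-\Pi_{k+1}^*S_{k+1}^{-1}\Pi_{k+1}$ ($k\ge0$), and the system determined by them is $W_{k+1}(\lambda)-W_k(\lambda)=-\frac{i}{\lambda}jC_kW_k(\lambda)$, $k\ge0$, with $W_0=I_m$. With $\mathbb C_-$ the open lower half-plane and $q(\lambda)=|\lambda|^2(|\lambda|^2+1)^{-1}$, a $p\times p$ matrix function $\varphi$ holomorphic in $\mathbb C_-$ is a Weyl function of the system if for every $\lambda\in\mathbb C_-$ the series $\sum_{k=0}^\infty [\varphi(\lambda)^*\ \ I_p]q(\lambda)^kW_k(\lambda)^*C_kW_k(\lambda)\begin{bmatrix}\varphi(\lambda)\\ I_p\end{bmatrix}$ converges. *)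

theory Defs
  imports "HOL-Analysis.Analysis" "Jordan_Normal_Form.Schur_Decomposition"
begin

definition minv :: "complex mat \<Rightarrow> complex mat" where
  "minv A = (SOME B. B \<in> carrier_mat (dim_row A) (dim_row A) \<and>
                     A * B = 1\<^sub>m (dim_row A) \<and> B * A = 1\<^sub>m (dim_row A))"

definition jmat :: "nat \<Rightarrow> complex mat" where
  "jmat p = four_block_mat (1\<^sub>m p) (0\<^sub>m p p) (0\<^sub>m p p) (- 1\<^sub>m p)"

definition pos_def_mat :: "nat \<Rightarrow> complex mat \<Rightarrow> bool" where
  "pos_def_mat n M \<longleftrightarrow> M \<in> carrier_mat n n \<and> mat_adjoint M = M \<and>
     (\<forall>v \<in> carrier_vec n. v \<noteq> 0\<^sub>v n \<longrightarrow> 0 < Re (conjugate v \<bullet> (M *\<^sub>v v)))"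

definition param_mats :: "nat \<Rightarrow> nat \<Rightarrow> complex mat \<Rightarrow> complex mat \<Rightarrow> complex mat \<Rightarrow> bool" where
  "param_mats p n A S0 Pi0 \<longleftrightarrow>
     A \<in> carrier_mat n n \<and> det A \<noteq> 0 \<and>
     S0 \<in> carrier_mat n n \<and> mat_adjoint S0 = S0 \<and>
     Pi0 \<in> carrier_mat n (2*p) \<and>
     A * S0 - S0 * mat_adjoint A = \<i> \<cdot>\<^sub>m (Pi0 * jmat p * mat_adjoint Pi0)"

fun Pi_seq :: "nat \<Rightarrow> complex mat \<Rightarrow> complex mat \<Rightarrow> nat \<Rightarrow> complex mat" where
  "Pi_seq p A Pi0 0 = Pi0"
| "Pi_seq p A Pi0 (Suc k) =
     Pi_seq p A Pi0 k + \<i> \<cdot>\<^sub>m (minv A * Pi_seq p A Pi0 k * jmat p)"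

fun S_seq :: "nat \<Rightarrow> complex mat \<Rightarrow> complex mat \<Rightarrow> complex mat \<Rightarrow> nat \<Rightarrow> complex mat" where
  "S_seq p A S0 Pi0 0 = S0"
| "S_seq p A S0 Pi0 (Suc k) =
     S_seq p A S0 Pi0 k
     + minv A * S_seq p A S0 Pi0 k * minv (mat_adjoint A)
     + minv A * Pi_seq p A Pi0 k * mat_adjoint (Pi_seq p A Pi0 k) * minv (mat_adjoint A)"

definition C_seq :: "nat \<Rightarrow> complex mat \<Rightarrow> complex mat \<Rightarrow> complex mat \<Rightarrow> nat \<Rightarrow> complex mat" where
  "C_seq p A S0 Pi0 k =
     1\<^sub>m (2*p)
     + mat_adjoint (Pi_seq p A Pi0 k) * minv (S_seq p A S0 Pi0 k) * Pi_seq p A Pi0 k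
     - mat_adjoint (Pi_seq p A Pi0 (Suc k)) * minv (S_seq p A S0 Pi0 (Suc k))
         * Pi_seq p A Pi0 (Suc k)"

fun W_seq :: "nat \<Rightarrow> complex mat \<Rightarrow> complex mat \<Rightarrow> complex mat \<Rightarrow> complex \<Rightarrow> nat \<Rightarrow> complex mat" where
  "W_seq p A S0 Pi0 z 0 = 1\<^sub>m (2*p)"
| "W_seq p A S0 Pi0 z (Suc k) =
     W_seq p A S0 Pi0 z k - (\<i> / z) \<cdot>\<^sub>m (jmat p * C_seq p A S0 Pi0 k * W_seq p A S0 Pi0 z k)"

definition lower_half_plane :: "complex set" where
  "lower_half_plane = {z. Im z < 0}"

definition qfun :: "complex \<Rightarrow> real" where
  "qfun z = (cmod z)^2 / ((cmod z)^2 + 1)"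

definition mat_series_converges :: "nat \<Rightarrow> nat \<Rightarrow> (nat \<Rightarrow> complex mat) \<Rightarrow> bool" where
  "mat_series_converges r c M \<longleftrightarrow>
     (\<forall>i<r. \<forall>l<c. summable (\<lambda>k. M k $$ (i, l)))"

definition mat_holomorphic_on :: "nat \<Rightarrow> nat \<Rightarrow> (complex \<Rightarrow> complex mat) \<Rightarrow> complex set \<Rightarrow> bool" where
  "mat_holomorphic_on r c f U \<longleftrightarrow>
     (\<forall>z\<in>U. f z \<in> carrier_mat r c) \<and>
     (\<forall>i<r. \<forall>l<c. (\<lambda>z. f z $$ (i, l)) holomorphic_on U)"

definition is_weyl_function ::
  "nat \<Rightarrow> complex mat \<Rightarrow> complex mat \<Rightarrow> complex mat \<Rightarrow> (complex \<Rightarrow> complex mat) \<Rightarrow> bool" where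
  "is_weyl_function p A S0 Pi0 \<phi> \<longleftrightarrow>
     mat_holomorphic_on p p \<phi> lower_half_plane \<and>
     (\<forall>z\<in>lower_half_plane.
        mat_series_converges p p (\<lambda>k.
          (qfun z ^ k) \<cdot>\<^sub>m
          (four_block_mat (mat_adjoint (\<phi> z)) (1\<^sub>m p) (0\<^sub>m 0 p) (0\<^sub>m 0 p)
           * mat_adjoint (W_seq p A S0 Pi0 z k) * C_seq p A S0 Pi0 k * W_seq p A S0 Pi0 z k
           * four_block_mat (\<phi> z) (0\<^sub>m p 0) (1\<^sub>m p) (0\<^sub>m p 0))))"

end

theory Submission
  imports Defs
begin

text \<open>
  Write \<open>j\<close> for the signature matrix. The recursions preserve \<open>S\<^sub>k > 0\<close> and the identity
  \<open>A S\<^sub>k - S\<^sub>k A\<^sup>* = \<i> \<Pi>\<^sub>k j \<Pi>\<^sub>k\<^sup>*\<close>, and they yield \<open>C\<^sub>k > 0\<close> and \<open>C\<^sub>k j C\<^sub>k = j\<close>.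
  The last identity makes \<open>q\<^sup>k W\<^sub>k\<^sup>* j W\<^sub>k\<close> telescope: its increments are positive multiples
  of \<open>q\<^sup>k W\<^sub>k\<^sup>* C\<^sub>k W\<^sub>k\<close>, so the Weyl series converges along a vector as soon as the
  indefinite form stays bounded above there.

  Existence: let \<open>(A - \<lambda>) X + \<i> \<Psi> \<Psi>\<^sup>* S\<^sub>0\<inverse> X = \<Psi>\<close> and \<open>\<phi> = -\<i> \<Phi>\<^sup>* S\<^sub>0\<inverse> X\<close>. The solution
  of the system starting at \<open>[\<phi>; I]\<close> is \<open>(1 + \<i>/\<lambda>)\<^sup>k (E - \<i> j \<Pi>\<^sub>k\<^sup>* S\<^sub>k\<inverse> X\<^sub>k)\<close> with
  \<open>X\<^sub>k = (I - \<i> A\<inverse>)\<^sup>k X\<close>, \<open>E = [0; I - \<i> \<Psi>\<^sup>* S\<^sub>0\<inverse> X]\<close>, and the indefinite form is nonpositive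
  on it. This formula avoids the resolvent of \<open>A\<close>, which may have poles in the lower
  half-plane. Uniqueness: \<open>C\<^sub>k \<ge> j\<close>, so along a vector whose lower half vanishes the terms of
  the series are bounded below by the squared norm of that vector.

  For the converse, choose \<open>T\<close> with \<open>T\<^sup>* S\<^sub>0 T = I\<close>; a change of basis by \<open>T\<close> turns the
  explicit formula for the Weyl function into the required representation.
\<close>

subsection \<open>Matrix algebra\<close>

lemma index_mat_adjoint [simp]:
  fixes A :: "complex mat"
  shows "i < dim_col A \<Longrightarrow> j < dim_row A \<Longrightarrow> mat_adjoint A $$ (i, j) = cnj (A $$ (j, i))"
    and "dim_row (mat_adjoint A) = dim_col A" and "dim_col (mat_adjoint A) = dim_row A"
  by (auto simp: mat_adjoint_def mat_of_rows_def cols_def)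

lemma mat_adjoint_carrier [simp]:
  fixes A :: "complex mat"
  shows "mat_adjoint A \<in> carrier_mat r c \<longleftrightarrow> A \<in> carrier_mat c r"
  by (metis carrier_matD carrier_matI index_mat_adjoint(2,3))

lemma mult_entry:
  "i < dim_row A \<Longrightarrow> j < dim_col B \<Longrightarrow>
    (A * B) $$ (i, j) = (\<Sum>k<dim_row B. A $$ (i, k) * B $$ (k, j))"
  if "dim_col A = dim_row B" for A B :: "'a :: semiring_0 mat"
  using that by (auto simp: scalar_prod_def atLeast0LessThan)

text \<open>The ring laws for matrices with hypotheses on dimensions instead of carriers: all
  variables of a hypothesis then occur in the left-hand side, so that the simplifier can
  use the laws as conditional rewrite rules.\<close>

named_theorems mat_ring

lemma mat_add_assoc [mat_ring]:
  fixes A B C :: "complex mat"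
  assumes "dim_row A = dim_row B" "dim_col A = dim_col B" "dim_row B = dim_row C"
      "dim_col B = dim_col C"
  shows "(A + B) + C = A + (B + C)"
  using assms by (intro eq_matI) auto

lemma mat_mult_assoc [mat_ring]:
  fixes A B C :: "complex mat"
  assumes "dim_col A = dim_row B" "dim_col B = dim_row C"
  shows "(A * B) * C = A * (B * C)"
  using assms by (intro assoc_mult_mat[of _ "dim_row A"
      "dim_row B" _ "dim_row C" _ "dim_col C"]) auto

lemma mat_distrib_left [mat_ring]:
  fixes A B C :: "complex mat"
  assumes "dim_row B = dim_row C" "dim_col B = dim_col C" "dim_col A = dim_row C"
  shows "A * (B + C) = A * B + A * C" "A * (B - C) = A * B - A * C"
  using assms by (auto intro!: mult_add_distrib_mat[of _ "dim_row A" "dim_row C" _ "dim_col C"]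
      mult_minus_distrib_mat[of _ "dim_row A" "dim_row C" _ "dim_col C"])

lemma mat_distrib_right [mat_ring]:
  fixes A B C :: "complex mat"
  assumes "dim_row A = dim_row B" "dim_col A = dim_col B" "dim_col B = dim_row C"
  shows "(A + B) * C = A * C + B * C" "(A - B) * C = A * C - B * C"
  using assms by (auto intro!: add_mult_distrib_mat[of _ "dim_row B" "dim_row C" _ _ "dim_col C"]
      minus_mult_distrib_mat[of _ "dim_row B" "dim_row C" _ _ "dim_col C"])

lemma mat_mult_smult [mat_ring]:
  fixes A B :: "complex mat"
  assumes "dim_col A = dim_row B"
  shows "A * (c \<cdot>\<^sub>m B) = c \<cdot>\<^sub>m (A * B)" "(c \<cdot>\<^sub>m A) * B = c \<cdot>\<^sub>m (A * B)"
  using assms by (auto intro!: mult_smult_distrib[of _ "dim_row A" "dim_row B" _ "dim_col B"]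
      mult_smult_assoc_mat[of _ "dim_row A" "dim_row B" _ "dim_col B"])

lemma mat_mult_uminus [mat_ring]:
  fixes A B :: "complex mat"
  assumes "dim_col A = dim_row B"
  shows "A * (- B) = - (A * B)" "(- A) * B = - (A * B)"
  using assms by auto

lemma mat_smult_distrib [mat_ring]:
  fixes A B :: "complex mat"
  assumes "dim_row A = dim_row B" "dim_col A = dim_col B"
  shows "c \<cdot>\<^sub>m (A + B) = c \<cdot>\<^sub>m A + c \<cdot>\<^sub>m B" "c \<cdot>\<^sub>m (A - B) = c \<cdot>\<^sub>m A - c \<cdot>\<^sub>m B"
  using assms by (auto intro!: eq_matI simp: algebra_simps)

lemma mat_smult_simps [mat_ring]:
  fixes A :: "complex mat"
  shows "c \<cdot>\<^sub>m (d \<cdot>\<^sub>m A) = (c * d) \<cdot>\<^sub>m A" "c \<cdot>\<^sub>m (- A) = (- c) \<cdot>\<^sub>m A" "1 \<cdot>\<^sub>m A = A"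
    "- (c \<cdot>\<^sub>m A) = (- c) \<cdot>\<^sub>m A" "- (- A) = A"
  by (auto intro!: eq_matI)

lemma mat_one_mult [mat_ring]:
  fixes A :: "complex mat"
  shows "dim_row A = k \<Longrightarrow> 1\<^sub>m k * A = A" "dim_col A = k \<Longrightarrow> A * 1\<^sub>m k = A"
  by auto

lemma mat_zero_mult [mat_ring]:
  fixes A :: "complex mat"
  shows "dim_row A = k \<Longrightarrow> 0\<^sub>m r k * A = 0\<^sub>m r (dim_col A)"
    "dim_col A = k \<Longrightarrow> A * 0\<^sub>m k c = 0\<^sub>m (dim_row A) c" "a \<cdot>\<^sub>m 0\<^sub>m r k = (0\<^sub>m r k :: complex mat)"
  by (auto intro!: left_mult_zero_mat right_mult_zero_mat)

lemma mat_adjoint_ops [mat_ring]: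
  fixes A B :: "complex mat"
  shows "dim_row A = dim_row B \<Longrightarrow> dim_col A = dim_col B \<Longrightarrow>
      mat_adjoint (A + B) = mat_adjoint A + mat_adjoint B"
    "dim_row A = dim_row B \<Longrightarrow> dim_col A = dim_col B \<Longrightarrow>
      mat_adjoint (A - B) = mat_adjoint A - mat_adjoint B"
    "dim_col A = dim_row B \<Longrightarrow> mat_adjoint (A * B) = mat_adjoint B * mat_adjoint A"
    "mat_adjoint (c \<cdot>\<^sub>m A) = cnj c \<cdot>\<^sub>m mat_adjoint A"
    "mat_adjoint (- A) = - mat_adjoint A"
    "mat_adjoint (mat_adjoint A) = A"
    "mat_adjoint (1\<^sub>m k) = (1\<^sub>m k :: complex mat)"
    "mat_adjoint (0\<^sub>m k l) = (0\<^sub>m l k :: complex mat)"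
  by (auto intro!: eq_matI sum.cong simp: mult_entry simp del: index_mult_mat(1))

text \<open>The rules \<open>mat_ring\<close> associate products to the right, so an identity for
  \<open>A * B\<close> matches inside a longer product only in this extended form.\<close>

lemma mult_eq_extend:
  fixes A B C Z :: "complex mat"
  assumes "A * B = C" "dim_col A = dim_row B" "dim_col B = dim_row Z"
  shows "A * (B * Z) = C * Z"
  using assms by (simp flip: mat_mult_assoc)

section \<open>Inverses, determinants and adjoints\<close>

lemma minv_props:
  assumes A: "A \<in> carrier_mat n n" and d: "det A \<noteq> 0"
  shows "minv A \<in> carrier_mat n n" "A * minv A = 1\<^sub>m n" "minv A * A = 1\<^sub>m n"
proof -
  have "(1 / det A) \<cdot>\<^sub>m (adj_mat A) \<in> carrier_mat n n \<and>
      A * ((1 / det A) \<cdot>\<^sub>m adj_mat A) = 1\<^sub>m n \<and> ((1 / det A) \<cdot>\<^sub>m adj_mat A) * A = 1\<^sub>m n"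
    using adj_mat[OF A] A d by (auto simp: mat_ring)
  then have "\<exists>B. B \<in> carrier_mat (dim_row A) (dim_row A) \<and>
      A * B = 1\<^sub>m (dim_row A) \<and> B * A = 1\<^sub>m (dim_row A)" using A by auto
  from someI_ex[OF this] show "minv A \<in> carrier_mat n n" "A * minv A = 1\<^sub>m n" "minv A * A = 1\<^sub>m n"
    using A by (auto simp: minv_def)
qed

text \<open>Multiplicativity of the determinant makes a one-sided inverse enough. As
  \<open>minv\<close> is a choice, its explicit values are obtained from this lemma.\<close>

lemma minv_unique:
  assumes A: "A \<in> carrier_mat n n" and B: "B \<in> carrier_mat n n" and AB: "A * B = 1\<^sub>m n"
  shows "det A \<noteq> 0" "minv A = B"
proof -
  have "det A * det B = 1" using det_mult[OF A B] AB by simp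
  then show d: "det A \<noteq> 0" by auto
  note m = minv_props[OF A d]
  have "minv A * A * B = minv A * (A * B)" using A B m(1) by (intro mat_mult_assoc) auto
  then have "1\<^sub>m n * B = minv A * 1\<^sub>m n" unfolding m(3) AB .
  then show "minv A = B" using m(1) B by simp
qed

lemma minv_adj_mat:
  assumes A: "A \<in> carrier_mat n n" and d: "det A \<noteq> 0"
  shows "minv A = (1 / det A) \<cdot>\<^sub>m adj_mat A"
  using adj_mat[OF A] A d by (intro minv_unique[OF A]) (auto simp: mat_ring)

lemma minv_adjoint:
  assumes A: "A \<in> carrier_mat n n" and d: "det A \<noteq> 0"
  shows "det (mat_adjoint A) \<noteq> 0" "minv (mat_adjoint A) = mat_adjoint (minv A)"
proof -
  note m = minv_props[OF A d]
  have "mat_adjoint (minv A * A) = mat_adjoint A * mat_adjoint (minv A)"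
    using A m(1) by (intro mat_adjoint_ops) auto
  then have "mat_adjoint A * mat_adjoint (minv A) = 1\<^sub>m n" unfolding m(3) by (simp add: mat_ring)
  with A m show "det (mat_adjoint A) \<noteq> 0" "minv (mat_adjoint A) = mat_adjoint (minv A)"
    using minv_unique[of "mat_adjoint A" n "mat_adjoint (minv A)"] by auto
qed

text \<open>The diagonal entries of \<open>Z\<^sup>* M Z\<close> are the values of the quadratic form of \<open>M\<close> at the
  columns of \<open>Z\<close>.\<close>

definition quad :: "complex mat \<Rightarrow> complex mat \<Rightarrow> nat \<Rightarrow> real" where
  "quad M Z i = Re ((mat_adjoint Z * M * Z) $$ (i, i))"

lemma quad_one:
  assumes "i < dim_col Z" "dim_row Z = n"
  shows "quad (1\<^sub>m n) Z i = (\<Sum>k<n. (cmod (Z $$ (k, i)))\<^sup>2)"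
proof -
  have "(mat_adjoint Z * 1\<^sub>m n * Z) $$ (i, i) = (\<Sum>k<n. cnj (Z $$ (k, i)) * Z $$ (k, i))"
    using assms by (simp add: mat_ring mult_entry del: index_mult_mat(1))
  then show ?thesis unfolding quad_def
    by (simp add: complex_norm_square[symmetric] mult.commute del: of_real_power)
qed

lemma quad_one_nonneg: "i < dim_col Z \<Longrightarrow> dim_row Z = n \<Longrightarrow> 0 \<le> quad (1\<^sub>m n) Z i"
  by (simp add: quad_one sum_nonneg)

lemma quad_one_pos:
  assumes "i < dim_col Z" "dim_row Z = n" "col Z i \<noteq> 0\<^sub>v n"
  shows "0 < quad (1\<^sub>m n) Z i"
proof -
  from assms obtain k where "k < n" "Z $$ (k, i) \<noteq> 0" by (auto simp: vec_eq_iff)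
  then show ?thesis using assms
    by (auto simp: quad_one intro!: sum_pos2[of _ k])
qed

lemma quad_vec:
  assumes "M \<in> carrier_mat n n" "dim_row Z = n" "i < dim_col Z"
  shows "quad M Z i = Re (conjugate (col Z i) \<bullet> (M *\<^sub>v col Z i))"
proof -
  have "(mat_adjoint Z * (M * Z)) $$ (i, i) = conjugate (col Z i) \<bullet> (M *\<^sub>v col Z i)"
    using assms by (auto simp: scalar_prod_def intro!: sum.cong)
  then show ?thesis using assms by (simp add: quad_def mat_ring del: index_mult_mat(1))
qed

section \<open>Positive definite matrices\<close>

lemma pos_def_quad_pos:
  assumes "pos_def_mat n M" "dim_row Z = n" "i < dim_col Z" "col Z i \<noteq> 0\<^sub>v n"
  shows "0 < quad M Z i"
  using assms quad_vec[of M n Z i] by (auto simp: pos_def_mat_def)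

lemma pos_def_quad_nonneg:
  assumes "pos_def_mat n M" "dim_row Z = n" "i < dim_col Z"
  shows "0 \<le> quad M Z i"
proof (cases "col Z i = 0\<^sub>v n")
  case True
  have "M \<in> carrier_mat n n" using assms by (simp add: pos_def_mat_def)
  moreover from this have "M *\<^sub>v 0\<^sub>v n = 0\<^sub>v n" by (auto simp: scalar_prod_def)
  ultimately show ?thesis using assms True quad_vec[of M n Z i] by simp
next
  case False
  with pos_def_quad_pos[OF assms] show ?thesis by simp
qed

text \<open>Vectors are replaced by matrices with one column, so that positivity can be checked by
  identities in the matrix ring.\<close>

lemma pos_def_matI:
  assumes "M \<in> carrier_mat n n" "mat_adjoint M = M"
    and "\<And>Z. Z \<in> carrier_mat n 1 \<Longrightarrow> col Z 0 \<noteq> 0\<^sub>v n \<Longrightarrow> 0 < quad M Z 0"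
  shows "pos_def_mat n M"
  unfolding pos_def_mat_def
proof (intro conjI ballI impI assms(1,2))
  fix v :: "complex vec" assume v: "v \<in> carrier_vec n" "v \<noteq> 0\<^sub>v n"
  define Z where "Z = mat n 1 (\<lambda>(i, j). v $ i)"
  have "col Z 0 = v" "Z \<in> carrier_mat n 1" using v by (auto simp: Z_def)
  with assms(3)[of Z] quad_vec[OF assms(1), of Z 0] v
  show "0 < Re (conjugate v \<bullet> (M *\<^sub>v v))" by simp
qed

lemma quad_congruence:
  assumes "M \<in> carrier_mat n n" "dim_row T = n" "dim_row Z = dim_col T"
  shows "quad (mat_adjoint T * M * T) Z i = quad M (T * Z) i"
  using assms by (simp add: quad_def mat_ring del: index_mult_mat(1))

lemma det_nonzeroI:
  fixes A :: "complex mat"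
  assumes A: "A \<in> carrier_mat n n"
    and "\<And>Z. Z \<in> carrier_mat n 1 \<Longrightarrow> col Z 0 \<noteq> 0\<^sub>v n \<Longrightarrow> A * Z = 0\<^sub>m n 1 \<Longrightarrow> False"
  shows "det A \<noteq> 0"
proof
  assume "det A = 0"
  then obtain v where v: "v \<in> carrier_vec n" "v \<noteq> 0\<^sub>v n" "A *\<^sub>v v = 0\<^sub>v n"
    using det_0_iff_vec_prod_zero[OF A] by auto
  define Z where "Z = mat n 1 (\<lambda>(i, j). v $ i)"
  have Z: "col Z 0 = v" "Z \<in> carrier_mat n 1" using v by (auto simp: Z_def)
  have "A * Z = 0\<^sub>m n 1"
  proof (intro eq_matI)
    fix i j assume "i < dim_row (0\<^sub>m n 1 :: complex mat)" "j < dim_col (0\<^sub>m n 1 :: complex mat)"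
    then show "(A * Z) $$ (i, j) = 0\<^sub>m n 1 $$ (i, j)"
      using v(3) Z A by (auto dest!: arg_cong[where f = "\<lambda>w. w $ i"])
  qed (use A Z in auto)
  with assms(2)[of Z] Z v show False by simp
qed

text \<open>The form would vanish at a kernel vector of \<open>S\<close>. For the last claim, the
  form of \<open>minv S\<close> at \<open>Z\<close> is the form of \<open>S\<close> at
  \<open>minv S * Z\<close>.\<close>

lemma pos_def_minv:
  assumes S: "pos_def_mat n S"
  shows "det S \<noteq> 0" "mat_adjoint (minv S) = minv S" "pos_def_mat n (minv S)"
proof -
  have Sc: "S \<in> carrier_mat n n" and Sa: "mat_adjoint S = S"
    using S by (auto simp: pos_def_mat_def)
  show d: "det S \<noteq> 0"
  proof (rule det_nonzeroI[OF Sc])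
    fix Z :: "complex mat"
    assume Z: "Z \<in> carrier_mat n 1" "col Z 0 \<noteq> 0\<^sub>v n" "S * Z = 0\<^sub>m n 1"
    have "quad S Z 0 = 0" using Sc Z by (simp add: quad_def mat_ring del: index_mult_mat(1))
    with pos_def_quad_pos[OF S, of Z 0] Z show False by simp
  qed
  note m = minv_props[OF Sc d]
  show ma: "mat_adjoint (minv S) = minv S" using minv_adjoint(2)[OF Sc d] Sa by simp
  show "pos_def_mat n (minv S)"
  proof (rule pos_def_matI[OF m(1) ma])
    fix Z :: "complex mat"
    assume Z: "Z \<in> carrier_mat n 1" "col Z 0 \<noteq> 0\<^sub>v n"
    have "mat_adjoint (minv S) * S * minv S = minv S"
      unfolding ma m(3) using m(1) by simp
    then have q: "quad (minv S) Z 0 = quad S (minv S * Z) 0"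
      using quad_congruence[of S n "minv S" Z 0] Sc m(1) Z(1) by simp
    have "col (minv S * Z) 0 \<noteq> 0\<^sub>v n"
    proof
      assume "col (minv S * Z) 0 = 0\<^sub>v n"
      then have "minv S * Z = 0\<^sub>m n 1" using m(1) Z(1) by (intro mat_col_eqI) auto
      moreover have "S * (minv S * Z) = Z"
        using mult_eq_extend[OF m(2), of Z] m(1) Sc Z(1) by (simp add: mat_ring)
      ultimately have "Z = 0\<^sub>m n 1" using Sc by (simp add: mat_ring)
      with Z(2) show False by simp
    qed
    then show "0 < quad (minv S) Z 0" unfolding q
      using pos_def_quad_pos[OF S, of "minv S * Z" 0] m(1) Z(1) by simp
  qed
qed

lemma pos_def_one: "pos_def_mat n (1\<^sub>m n)"
  by (rule pos_def_matI) (simp_all add: mat_ring quad_one_pos)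

text \<open>With \<open>B\<close> the inverse of \<open>A\<close> this is the step of the recursion
  for \<open>S_seq\<close>. The new form at \<open>Z\<close> is the form of \<open>S\<close> at
  \<open>Z\<close>, plus its value at the adjoint of \<open>B\<close> times \<open>Z\<close>, plus a
  squared norm.\<close>

lemma pos_def_update:
  assumes S: "pos_def_mat n S" and [simp]: "dim_row B = n" "dim_col B = n" "dim_row P = n"
  shows "pos_def_mat n (S + B * S * mat_adjoint B + B * P * mat_adjoint P * mat_adjoint B)"
proof (rule pos_def_matI)
  have Sc: "S \<in> carrier_mat n n" and Sa: "mat_adjoint S = S" using S
      by (auto simp: pos_def_mat_def)
  have [simp]: "dim_row S = n" "dim_col S = n" using Sc by auto
  show "S + B * S * mat_adjoint B + B * P * mat_adjoint P * mat_adjoint B \<in> carrier_mat n n"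
    by (intro carrier_matI) simp_all
  show "mat_adjoint (S + B * S * mat_adjoint B + B * P * mat_adjoint P * mat_adjoint B) =
      S + B * S * mat_adjoint B + B * P * mat_adjoint P * mat_adjoint B"
    by (simp add: mat_ring Sa)
  fix Z :: "complex mat" assume Z: "Z \<in> carrier_mat n 1" "col Z 0 \<noteq> 0\<^sub>v n"
  have [simp]: "dim_row Z = n" "dim_col Z = 1" using Z(1) by auto
  define U where "U = mat_adjoint B * Z"
  define V where "V = mat_adjoint P * (mat_adjoint B * Z)"
  have "quad (S + B * S * mat_adjoint B + B * P * mat_adjoint P * mat_adjoint B) Z 0
      = quad S Z 0 + quad S U 0 + quad (1\<^sub>m (dim_col P)) V 0"
    by (simp add: quad_def U_def V_def mat_ring del: index_mult_mat(1))
  moreover have "0 < quad S Z 0" by (rule pos_def_quad_pos[OF S]) (use Z(2) in simp_all)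
  moreover have "0 \<le> quad S U 0" by (rule pos_def_quad_nonneg[OF S]) (simp_all add: U_def)
  moreover have "0 \<le> quad (1\<^sub>m (dim_col P)) V 0" by (rule quad_one_nonneg) (simp_all add: V_def)
  ultimately show "0 < quad (S + B * S * mat_adjoint B
      + B * P * mat_adjoint P * mat_adjoint B) Z 0"
    by linarith
qed

text \<open>Entries of a positive semidefinite matrix are dominated by its diagonal, which reduces
  convergence of the matrix series to its diagonal entries.\<close>

lemma quad_entry_bound:
  assumes H: "pos_def_mat m H" and [simp]: "dim_row Z = m" "i < dim_col Z" "l < dim_col Z"
  shows "cmod ((mat_adjoint Z * H * Z) $$ (i, l)) \<le> (quad H Z i + quad H Z l) / 2"
proof -
  have Hc: "H \<in> carrier_mat m m" and Ha: "mat_adjoint H = H" using H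
      by (auto simp: pos_def_mat_def)
  have [simp]: "dim_row H = m" "dim_col H = m" using Hc by auto
  define F where "F = mat_adjoint Z * H * Z"
  define r where "r = dim_col Z"
  have il: "i < r" "l < r" using assms(3,4) unfolding r_def .
  have [simp]: "dim_col Z = r" by (simp add: r_def)
  have [simp]: "dim_row F = r" "dim_col F = r" by (simp_all add: F_def)
  have Fa: "mat_adjoint F = F" by (simp add: F_def mat_ring Ha)
  have Fli: "F $$ (l, i) = cnj (F $$ (i, l))"
    using il arg_cong[OF Fa, of "\<lambda>M. M $$ (l, i)"] by simp
  define e where "e a = mat r 1 (\<lambda>(b, c). if b = a then 1 else 0 :: complex)" for a
  have [simp]: "dim_row (e a) = r" "dim_col (e a) = 1" for a by (simp_all add: e_def)
  have Fe: "(mat_adjoint (e a) * (F * e b)) $$ (0, 0) = F $$ (a, b)" if "a < r" "b < r" for a b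
  proof -
    have "(F * e b) $$ (k, 0) = F $$ (k, b)" if "k < r" for k
      using that \<open>b < r\<close>
          by (simp add: mult_entry e_def if_distrib cong: if_cong del: index_mult_mat(1))
    then show ?thesis using that
      by (simp add: mult_entry e_def if_distrib if_distribR cong: if_cong del: index_mult_mat(1))
  qed
  \<comment> \<open>The phase \<open>w\<close> turns both cross terms of the form of
    \<open>F\<close> at \<open>e i + w e l\<close> into minus the modulus of the entry.\<close>
  obtain w where w: "cmod w = 1" "w * F $$ (i, l) = - complex_of_real (cmod (F $$ (i, l)))"
  proof (cases "F $$ (i, l) = 0")
    case True
    then show ?thesis using that[of 1] by simp
  next
    case False
    let ?w = "- (cnj (F $$ (i, l)) / cmod (F $$ (i, l)))"
    have "cmod ?w = 1" using False by (simp add: norm_divide)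
    moreover have "?w * F $$ (i, l) = - complex_of_real (cmod (F $$ (i, l)))"
      using False complex_norm_square[of "F $$ (i, l)"]
      by (simp add: field_simps power2_eq_square)
    ultimately show ?thesis using that by blast
  qed
  have ww: "w * cnj w = 1" using w(1) complex_norm_square[of w] by simp
  have w': "cnj w * cnj (F $$ (i, l)) = - complex_of_real (cmod (F $$ (i, l)))"
    unfolding complex_cnj_mult[symmetric] w(2) by simp
  define V where "V = e i + w \<cdot>\<^sub>m e l"
  have [simp]: "dim_row V = r" "dim_col V = 1" by (simp_all add: V_def)
  have "(mat_adjoint V * (F * V)) $$ (0, 0) =
      F $$ (i, i) + w * F $$ (i, l) + cnj w * F $$ (l, i) + (w * cnj w) * F $$ (l, l)"
    by (simp add: V_def mat_ring Fe il algebra_simps del: index_mult_mat(1))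
  then have "quad F V 0 = Re (F $$ (i, i)) + Re (F $$ (l, l)) - 2 * cmod (F $$ (i, l))"
    unfolding ww Fli w(2) w' quad_def
    by (simp add: mat_ring del: index_mult_mat(1))
  moreover have "0 \<le> quad F V 0"
    unfolding F_def using quad_congruence[OF Hc, of Z V 0]
      pos_def_quad_nonneg[OF H, of "Z * V" 0] by simp
  ultimately show ?thesis by (simp add: F_def quad_def)
qed

subsection \<open>One step of the recursion\<close>

text \<open>Below \<open>R\<close> and \<open>R'\<close> are the inverses of \<open>S\<close> and \<open>S'\<close>, \<open>B\<close> is the inverse of \<open>A\<close>, and
  the primes denote the next index of the recursion.\<close>

locale dirac_step =
  fixes n m :: nat and A B S R S' R' P P' J :: "complex mat"
  assumes dims [simp]: "dim_row A = n" "dim_col A = n" "dim_row B = n" "dim_col B = n"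
    "dim_row S = n" "dim_col S = n" "dim_row R = n" "dim_col R = n"
    "dim_row R' = n" "dim_col R' = n"
    "dim_row P = n" "dim_col P = m" "dim_row J = m" "dim_col J = m"
    and AB: "A * B = 1\<^sub>m n" and BA: "B * A = 1\<^sub>m n"
    and SR: "S * R = 1\<^sub>m n" and RS: "R * S = 1\<^sub>m n"
    and SR': "S' * R' = 1\<^sub>m n" and RS': "R' * S' = 1\<^sub>m n"
    and adj: "mat_adjoint S = S" "mat_adjoint R = R" "mat_adjoint R' = R'" "mat_adjoint J = J"
    and JJ: "J * J = 1\<^sub>m m"
    and lyapunov: "A * S - S * mat_adjoint A = \<i> \<cdot>\<^sub>m (P * J * mat_adjoint P)"
    and P'_def: "P' = P + \<i> \<cdot>\<^sub>m (B * P * J)"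
    and S'_def: "S' = S + B * S * mat_adjoint B + B * P * mat_adjoint P * mat_adjoint B"
begin

abbreviation "Ah \<equiv> mat_adjoint A"
abbreviation "Bh \<equiv> mat_adjoint B"
abbreviation "Ph \<equiv> mat_adjoint P"
abbreviation "Ph' \<equiv> mat_adjoint P'"

definition "C = 1\<^sub>m m + Ph * R * P - Ph' * R' * P'"

lemma dims' [simp]: "dim_row P' = n" "dim_col P' = m" "dim_row S' = n" "dim_col S' = n"
  by (simp_all add: P'_def S'_def)

lemma dims_C [simp]: "dim_row C = m" "dim_col C = m"
  by (simp_all add: C_def)

lemma BhAh: "Bh * Ah = 1\<^sub>m n" and AhBh: "Ah * Bh = 1\<^sub>m n"
  using arg_cong[OF AB, of mat_adjoint] arg_cong[OF BA, of mat_adjoint]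
      by (simp_all add: mat_ring)

lemma cancel:
  assumes "dim_row Z = n"
  shows "A * (B * Z) = Z" "B * (A * Z) = Z" "S * (R * Z) = Z" "R * (S * Z) = Z"
    "S' * (R' * Z) = Z" "R' * (S' * Z) = Z" "Ah * (Bh * Z) = Z" "Bh * (Ah * Z) = Z"
  using assms by (simp_all add: mult_eq_extend[OF AB] mult_eq_extend[OF BA] mult_eq_extend[OF SR]
      mult_eq_extend[OF RS] mult_eq_extend[OF SR'] mult_eq_extend[OF RS'] mult_eq_extend[OF AhBh]
      mult_eq_extend[OF BhAh] mat_ring)

lemma JJ_cancel: "dim_row Z = m \<Longrightarrow> J * (J * Z) = Z"
  by (simp add: mult_eq_extend[OF JJ] mat_ring)

lemmas cancels = cancel JJ_cancel AB BA SR RS SR' RS' BhAh AhBh JJ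

lemma adj_S' : "mat_adjoint S' = S'"
  by (simp add: S'_def mat_ring adj)

lemma adj_C: "mat_adjoint C = C"
  by (simp add: C_def mat_ring adj)

text \<open>Solved for the product, the Lyapunov identity becomes a rewrite rule that removes
  \<open>J\<close> between \<open>P\<close> and its adjoint. Lemmas below do the same for the other
  pairings of \<open>P\<close> and \<open>P'\<close>.\<close>

lemma PJPh: "P * (J * Ph) = (-\<i>) \<cdot>\<^sub>m (A * S - S * Ah)"
  unfolding lyapunov by (simp add: mat_ring)

lemma AS: "A * S = S * Ah + \<i> \<cdot>\<^sub>m (P * (J * Ph))"
  unfolding PJPh by (rule eq_matI) (simp_all add: algebra_simps del: index_mult_mat(1))

text \<open>A Lyapunov identity linking consecutive indices: multiplying the recursion for
  \<open>S'\<close> by \<open>Ah\<close> cancels \<open>Bh\<close>, and \<open>P' * J\<close>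
  supplies the remaining term \<open>B * P\<close>.\<close>

lemma S'Ah: "S' * Ah = A * S + B * S - \<i> \<cdot>\<^sub>m (P' * (J * Ph))"
  by (rule eq_matI) (simp_all add: S'_def P'_def mat_ring cancels AS algebra_simps
      del: index_mult_mat(1))

lemma SBh: "S * Bh = B * S + \<i> \<cdot>\<^sub>m (B * (P * (J * (Ph * Bh))))"
  using arg_cong[OF AS, of "\<lambda>M. B * (M * Bh)"] by (simp add: mat_ring cancels)

text \<open>Both sides reduce to the identity for \<open>S\<close> and to its conjugate
  \<open>SBh\<close> by \<open>B\<close>. This is the induction step that keeps the identity along
  the recursion.\<close>

lemma lyapunov': "A * S' - S' * Ah = \<i> \<cdot>\<^sub>m (P' * J * Ph')"
proof -
  have "A * S' = A * S + S * Bh + P * (Ph * Bh)" "S' * Ah = S * Ah + B * S + B * (P * Ph)"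
    by (simp_all add: S'_def mat_ring cancels)
  then show ?thesis
    by (intro eq_matI) (simp_all add: P'_def mat_ring cancels adj AS SBh algebra_simps
        del: index_mult_mat(1))
qed

lemma P'JPh: "P' * (J * Ph) = \<i> \<cdot>\<^sub>m (S' * Ah - A * S - B * S)"
  unfolding S'Ah by (rule eq_matI) (simp_all add: mat_ring algebra_simps del: index_mult_mat(1))

lemma PJP'h: "P * (J * Ph') = (-\<i>) \<cdot>\<^sub>m (A * S' - S * Ah - S * Bh)"
  using arg_cong[OF P'JPh, of mat_adjoint] by (simp add: mat_ring adj adj_S')

lemma P'JP'h: "P' * (J * Ph') = (-\<i>) \<cdot>\<^sub>m (A * S' - S' * Ah)"
  unfolding lyapunov' by (simp add: mat_ring)

lemma P'hAh: "Ph' * Ah = Ph * Ah - \<i> \<cdot>\<^sub>m (J * Ph)"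
  by (rule eq_matI) (simp_all add: P'_def mat_ring cancels adj algebra_simps
      del: index_mult_mat(1))

lemma JP'h: "J * Ph' = J * Ph - \<i> \<cdot>\<^sub>m (Ph * Bh)"
  by (rule eq_matI) (simp_all add: P'_def mat_ring cancels adj algebra_simps
      del: index_mult_mat(1))

lemma AP': "A * P' = A * P + \<i> \<cdot>\<^sub>m (P * J)"
  by (simp add: P'_def mat_ring cancels)

lemma P'J: "P' * J = P * J + \<i> \<cdot>\<^sub>m (B * P)"
  by (simp add: P'_def mat_ring cancels)

text \<open>The preceding identities with a trailing factor, the shape in which they occur in
  right-associated products.\<close>

lemma prefix:
  assumes "dim_row Z = n"
  shows "P * (J * (Ph * Z)) = (-\<i>) \<cdot>\<^sub>m (A * (S * Z) - S * (Ah * Z))"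
    "P' * (J * (Ph * Z)) = \<i> \<cdot>\<^sub>m (S' * (Ah * Z) - A * (S * Z) - B * (S * Z))"
    "P * (J * (Ph' * Z)) = (-\<i>) \<cdot>\<^sub>m (A * (S' * Z) - S * (Ah * Z) - S * (Bh * Z))"
    "P' * (J * (Ph' * Z)) = (-\<i>) \<cdot>\<^sub>m (A * (S' * Z) - S' * (Ah * Z))"
    "Ph' * (Ah * Z) = Ph * (Ah * Z) - \<i> \<cdot>\<^sub>m (J * (Ph * Z))"
    "J * (Ph' * Z) = J * (Ph * Z) - \<i> \<cdot>\<^sub>m (Ph * (Bh * Z))"
  using assms arg_cong[OF PJPh, of "\<lambda>M. M * Z"] arg_cong[OF P'JPh, of "\<lambda>M. M * Z"]
    arg_cong[OF PJP'h, of "\<lambda>M. M * Z"] arg_cong[OF P'JP'h, of "\<lambda>M. M * Z"]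
    arg_cong[OF P'hAh, of "\<lambda>M. M * Z"] arg_cong[OF JP'h, of "\<lambda>M. M * Z"]
  by (simp_all add: mat_ring)

text \<open>Here and in \<open>CJQ'\<close> the product \<open>C * J\<close> is evaluated on the
  left factors \<open>Ph * R\<close> and \<open>Ph' * R'\<close> of the two nontrivial summands of
  \<open>C\<close>, in preparation for \<open>CJC\<close>.\<close>

lemma CJQ: "C * (J * (Ph * R))
    = \<i> \<cdot>\<^sub>m (Ph' * (R' * A)) + \<i> \<cdot>\<^sub>m (Ph' * (R' * B)) - \<i> \<cdot>\<^sub>m (Ph * (R * A))"
  by (rule eq_matI) (simp_all add: C_def mat_ring cancels prefix(1-5) algebra_simps
      del: index_mult_mat(1))

lemma CJQ': "C * (J * (Ph' * R')) = \<i> \<cdot>\<^sub>m (Ph' * (R' * A)) - \<i> \<cdot>\<^sub>m (Ph * (R * A))"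
proof -
  have "C * (J * (Ph' * R'))
      = J * (Ph' * R') + Ph * (R * (P * (J * (Ph' * R')))) - Ph' * (R' * (P' * (J * (Ph' * R'))))"
    by (simp add: C_def mat_ring)
  \<comment> \<open>The products with \<open>J\<close> between are replaced first:
    \<open>prefix(6)\<close> would rewrite the inner \<open>J * (Ph' * R')\<close> and hide
    them.\<close>
  also have "\<dots> = \<i> \<cdot>\<^sub>m (Ph' * (R' * A)) - \<i> \<cdot>\<^sub>m (Ph * (R * A))"
    unfolding prefix(3,4)[of R', simplified]
    by (rule eq_matI) (simp_all add: mat_ring cancels prefix(5,6) algebra_simps
        del: index_mult_mat(1))
  finally show ?thesis .
qed

text \<open>Expanding the right factor \<open>C\<close> leaves \<open>C * J\<close>,
  \<open>CJQ\<close> times \<open>P\<close> and \<open>CJQ'\<close> times \<open>P'\<close>. The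
  recursion for \<open>P'\<close> then cancels everything but \<open>J\<close>.\<close>

lemma CJC: "C * (J * C) = J"
proof -
  have "C * (J * C) = C * J + (C * (J * (Ph * R))) * P - (C * (J * (Ph' * R'))) * P'"
    by (subst (2) C_def) (simp add: mat_ring)
  also have "\<dots> = J" unfolding CJQ CJQ'
    by (rule eq_matI) (simp_all add: C_def mat_ring AP' P'J algebra_simps del: index_mult_mat(1))
  finally show ?thesis .
qed

section \<open>Explicit solutions and the energy balance\<close>

lemma CJQX:
  assumes "dim_row X = n"
  shows "C * (J * (Ph * (R * X))) =
    \<i> \<cdot>\<^sub>m (Ph' * (R' * (A * X))) + \<i> \<cdot>\<^sub>m (Ph' * (R' * (B * X))) - \<i> \<cdot>\<^sub>m (Ph * (R * (A * X)))"
  using assms arg_cong[OF CJQ, of "\<lambda>M. M * X"] by (simp add: mat_ring)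

text \<open>In \<open>C * Y\<close> the terms with \<open>R * (A * X)\<close> coming from
  \<open>E\<close> and from \<open>CJQX\<close> cancel, and
  \<open>A * X - A * X' + B * X = \<i> X'\<close> collects the primed ones.\<close>

lemma solution_step:
  assumes [simp]: "dim_row X = n" "dim_row E = m" "dim_col E = dim_col X"
    and JE: "J * E = - E" and PE: "P * E = A * X - z \<cdot>\<^sub>m X" and z: "z \<noteq> 0"
    and Y: "Y = E - \<i> \<cdot>\<^sub>m (J * (Ph * (R * X)))" and X': "X' = X - \<i> \<cdot>\<^sub>m (B * X)"
  shows "Y - (\<i> / z) \<cdot>\<^sub>m (J * (C * Y)) = (1 + \<i> / z) \<cdot>\<^sub>m (E - \<i> \<cdot>\<^sub>m (J * (Ph' * (R' * X'))))"
    and "P' * E = A * X' - z \<cdot>\<^sub>m X'"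
proof -
  have dX' [simp]: "dim_row X' = n" "dim_col X' = dim_col X" by (simp_all add: X')
  show P'E: "P' * E = A * X' - z \<cdot>\<^sub>m X'"
    by (rule eq_matI) (simp_all add: P'_def X' mat_ring cancels JE PE algebra_simps
        del: index_mult_mat(1))
  have CE: "C * E = E + Ph * (R * (A * X)) - z \<cdot>\<^sub>m (Ph * (R * X)) - Ph' * (R' * (A * X'
      - z \<cdot>\<^sub>m X'))"
    by (rule eq_matI) (simp_all add: C_def mat_ring PE P'E algebra_simps del: index_mult_mat(1))
  have CY: "C * Y = E - z \<cdot>\<^sub>m (Ph * (R * X)) + (z + \<i>) \<cdot>\<^sub>m (Ph' * (R' * X'))"
    unfolding Y
    by (rule eq_matI) (simp_all add: mat_ring cancels CE CJQX X' algebra_simps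
        del: index_mult_mat(1))
  show "Y - (\<i> / z) \<cdot>\<^sub>m (J * (C * Y)) = (1 + \<i> / z) \<cdot>\<^sub>m (E - \<i> \<cdot>\<^sub>m (J * (Ph' * (R' * X'))))"
    unfolding CY using z unfolding Y
    by (intro eq_matI) (simp_all add: dX' mat_ring JE field_simps del: index_mult_mat(1))
qed

text \<open>Replacing \<open>P * E\<close> by the hypothesis and \<open>P * (J * Ph)\<close> by the
  Lyapunov identity cancels all terms in \<open>A\<close>; only the imaginary part of
  \<open>z\<close> survives. If \<open>J * E = - E\<close>, \<open>R\<close> is positive and
  \<open>Im z < 0\<close>, both summands have nonpositive diagonal.\<close>

lemma energy:
  assumes [simp]: "dim_row X = n" "dim_row E = m" "dim_col E = dim_col X"
    and PE: "P * E = A * X - z \<cdot>\<^sub>m X"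
    and Y: "Y = E - \<i> \<cdot>\<^sub>m (J * (Ph * (R * X)))"
  shows "mat_adjoint Y * J * Y =
    mat_adjoint E * J * E + complex_of_real (2 * Im z) \<cdot>\<^sub>m (mat_adjoint X * R * X)"
proof -
  have EhPh: "mat_adjoint E * Ph = mat_adjoint X * Ah - cnj z \<cdot>\<^sub>m mat_adjoint X"
    using arg_cong[OF PE, of mat_adjoint] by (simp add: mat_ring)
  have EhPhZ: "mat_adjoint E * (Ph * Z)
      = mat_adjoint X * (Ah * Z) - cnj z \<cdot>\<^sub>m (mat_adjoint X * Z)"
    if "dim_row Z = n" for Z
    using that arg_cong[OF EhPh, of "\<lambda>M. M * Z"] by (simp add: mat_ring)
  have 2: "2 * complex_of_real (Im z) = \<i> * cnj z - \<i> * z"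
    by (simp add: complex_eq_iff)
  show ?thesis unfolding Y
    by (rule eq_matI) (simp_all add: 2 mat_ring adj cancels EhPhZ PE prefix(1) algebra_simps
        del: index_mult_mat(1))
qed

text \<open>The term quadratic in the step contains \<open>C * J * C\<close>, which
  \<open>CJC\<close> turns into \<open>J\<close>; the two cross terms combine to a real multiple of
  the form of \<open>C\<close>. The factor of the old form is \<open>1 / qfun z\<close>.\<close>

lemma telescope:
  assumes [simp]: "dim_row Y = m" and z: "z \<noteq> 0"
    and Y': "Y' = Y - (\<i> / z) \<cdot>\<^sub>m (J * (C * Y))"
  shows "mat_adjoint Y' * J * Y'
      = (1 + 1 / complex_of_real ((cmod z)\<^sup>2)) \<cdot>\<^sub>m (mat_adjoint Y * J * Y)
    + complex_of_real (- 2 * Im z / (cmod z)\<^sup>2) \<cdot>\<^sub>m (mat_adjoint Y * C * Y)"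
proof -
  have CJCZ: "C * (J * (C * Z)) = J * Z" if "dim_row Z = m" for Z
    using that arg_cong[OF CJC, of "\<lambda>M. M * Z"] by (simp add: mat_ring)
  have z2: "(complex_of_real (cmod z))\<^sup>2 = z * cnj z"
    by (metis complex_norm_square of_real_power)
  have 2: "complex_of_real (Im z) = (\<i> * cnj z - \<i> * z) / 2"
    by (simp add: complex_eq_iff)
  show ?thesis unfolding Y' using z
    by (intro eq_matI)
      (simp_all add: z2 2 mat_ring adj adj_C cancels CJCZ field_simps del: index_mult_mat(1))
qed

text \<open>\<open>C\<close> is the Schur complement of \<open>S'\<close> in \<open>[S', P'; P'\<^sup>*, I + P\<^sup>* R P]\<close>, whose quadratic form
  at \<open>(x, y)\<close> is the sum of the forms of \<open>R\<close> at \<open>S x + P y\<close>, of \<open>S\<close> at \<open>B\<^sup>* x\<close> and of \<open>I\<close> at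
  \<open>P\<^sup>* B\<^sup>* x + \<i> J y\<close>.\<close>

lemma C_pos_def:
  assumes S: "pos_def_mat n S" and R: "pos_def_mat n R"
  shows "pos_def_mat m C"
proof (rule pos_def_matI[OF _ adj_C])
  show "C \<in> carrier_mat m m" by (intro carrier_matI) auto
  fix y :: "complex mat" assume y: "y \<in> carrier_mat m 1" "col y 0 \<noteq> 0\<^sub>v m"
  then have [simp]: "dim_row y = m" "dim_col y = 1" by auto
  \<comment> \<open>The critical point of the block form in its first argument for fixed
    \<open>y\<close>; the value there is the form of the Schur complement \<open>C\<close> at
    \<open>y\<close>.\<close>
  define x where "x = - (R' * (P' * y))"
  have [simp]: "dim_row x = n" "dim_col x = 1" by (simp_all add: x_def)
  have R'x: "R' * (P' * y) = - x" by (simp add: x_def mat_ring)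
  have *: "S' * x = - (P' * y)" by (simp add: x_def mat_ring cancels)
  have Sx: "S * x = - (B * (S * (Bh * x))) - B * (P * (Ph * (Bh * x))) - P * y
      - \<i> \<cdot>\<^sub>m (B * (P * (J * y)))" (is "_ = ?r")
  proof (rule eq_matI)
    fix i j assume "i < dim_row ?r" "j < dim_col ?r"
    then show "(S * x) $$ (i, j) = ?r $$ (i, j)"
      using arg_cong[OF *, of "\<lambda>M. M $$ (i, j)"]
      by (simp add: S'_def P'_def mat_ring eq_diff_eq eq_neg_iff_add_eq_0 add_ac
          del: index_mult_mat(1))
  qed simp_all
  define u where "u = S * x + P * y"
  define v where "v = Ph * (Bh * x) + \<i> \<cdot>\<^sub>m (J * y)"
  have [simp]: "dim_row u = n" "dim_col u = 1" "dim_row v = m" "dim_col v = 1"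
    by (simp_all add: u_def v_def)
  have "mat_adjoint y * C * y
      = mat_adjoint u * R * u + mat_adjoint (Bh * x) * S * (Bh * x) + mat_adjoint v * 1\<^sub>m m * v"
  proof -
    have "mat_adjoint u * R * u
        = mat_adjoint x * (S * x) + mat_adjoint x * (P * y) + mat_adjoint y * (Ph * x)
       + mat_adjoint y * (Ph * (R * (P * y)))"
      by (rule eq_matI) (simp_all add: u_def mat_ring adj cancels algebra_simps
          del: index_mult_mat(1))
    moreover have "mat_adjoint y * C * y
        = mat_adjoint y * y + mat_adjoint y * (Ph * (R * (P * y)))
       + mat_adjoint y * (Ph * x) - \<i> \<cdot>\<^sub>m (mat_adjoint y * (J * (Ph * (Bh * x))))"
      by (rule eq_matI, simp_all add: C_def mat_ring R'x del: index_mult_mat(1))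
        (simp_all add: P'_def mat_ring adj algebra_simps del: index_mult_mat(1))
    ultimately show ?thesis unfolding Sx
      by (intro eq_matI) (simp_all add: v_def mat_ring adj cancels algebra_simps
          del: index_mult_mat(1))
  qed
  then have q: "quad C y 0 = quad R u 0 + quad S (Bh * x) 0 + quad (1\<^sub>m m) v 0"
    by (simp add: quad_def del: index_mult_mat(1))
  have u0: "0 \<le> quad R u 0" by (rule pos_def_quad_nonneg[OF R]) simp_all
  have v0: "0 \<le> quad (1\<^sub>m m) v 0" by (rule quad_one_nonneg) simp_all
  have S0: "0 \<le> quad S (Bh * x) 0" by (rule pos_def_quad_nonneg[OF S]) simp_all
  show "0 < quad C y 0"
  \<comment> \<open>Strictness: if the form of \<open>S\<close> contributes nothing,
    \<open>v\<close> reduces to \<open>\<i> J y\<close>, which is nonzero because \<open>J\<close>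
    is an involution.\<close>
  proof (cases "col (Bh * x) 0 = 0\<^sub>v n")
    case False
    then have "0 < quad S (Bh * x) 0" by (intro pos_def_quad_pos[OF S]) simp_all
    with q u0 v0 show ?thesis by simp
  next
    case True
    then have "Bh * x = 0\<^sub>m n 1" by (intro mat_col_eqI) auto
    then have v: "v = \<i> \<cdot>\<^sub>m (J * y)"
      unfolding v_def by (intro eq_matI) (simp_all add: mat_ring del: index_mult_mat(1))
    have "col v 0 \<noteq> 0\<^sub>v m"
    proof
      assume "col v 0 = 0\<^sub>v m"
      then have "v = 0\<^sub>m m 1" by (intro mat_col_eqI) auto
      then have "(-\<i>) \<cdot>\<^sub>m (J * v) = 0\<^sub>m m 1" by (simp add: mat_ring)
      then have "y = 0\<^sub>m m 1" by (simp add: v mat_ring cancels)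
      with y show False by simp
    qed
    then have "0 < quad (1\<^sub>m m) v 0" by (intro quad_one_pos) simp_all
    with q u0 S0 show ?thesis by simp
  qed
qed

text \<open>The reason is \<open>(C - J) J C J (C - J) = 2 (C - J)\<close>, a consequence of \<open>C J C = J\<close>.\<close>

lemma quad_J_le_C:
  assumes C: "pos_def_mat m C" and [simp]: "dim_row Z = m" "i < dim_col Z"
  shows "quad J Z i \<le> quad C Z i"
proof -
  have CJCZ: "C * (J * (C * Z)) = J * Z" if "dim_row Z = m" for Z
    using that arg_cong[OF CJC, of "\<lambda>M. M * Z"] by (simp add: mat_ring)
  define V where "V = J * ((C - J) * Z)"
  have "mat_adjoint V * C * V = complex_of_real 2 \<cdot>\<^sub>m (mat_adjoint Z * (C - J) * Z)"
    unfolding V_def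
    by (rule eq_matI) (simp_all add: mat_ring adj adj_C CJCZ CJC cancels del: index_mult_mat(1))
  then have "quad C V i = 2 * (quad C Z i - quad J Z i)"
    by (simp add: quad_def mat_ring del: index_mult_mat(1))
  moreover have "0 \<le> quad C V i" by (rule pos_def_quad_nonneg[OF C]) (simp_all add: V_def)
  ultimately show ?thesis by simp
qed

end

subsection \<open>Block columns and normalization of positive definite matrices\<close>

text \<open>In terms of \<open>blk1 = [I; 0]\<close> and \<open>blk2 = [0; I]\<close> all block computations become identities of
  the matrix ring, so that the rules \<open>mat_ring\<close> apply to them.\<close>

definition blk1 :: "nat \<Rightarrow> nat \<Rightarrow> complex mat" where
  "blk1 p q = mat (p + q) p (\<lambda>(i, j). if i = j then 1 else 0)"

definition blk2 :: "nat \<Rightarrow> nat \<Rightarrow> complex mat" where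
  "blk2 p q = mat (p + q) q (\<lambda>(i, j). if i = p + j then 1 else 0)"

lemma blk_dims [simp]:
  "dim_row (blk1 p q) = p + q" "dim_col (blk1 p q) = p"
  "dim_row (blk2 p q) = p + q" "dim_col (blk2 p q) = q"
  by (simp_all add: blk1_def blk2_def)

lemma blk_index:
  "i < p + q \<Longrightarrow> j < p \<Longrightarrow> blk1 p q $$ (i, j) = (if i = j then 1 else 0)"
  "i < p + q \<Longrightarrow> j < q \<Longrightarrow> blk2 p q $$ (i, j) = (if i = p + j then 1 else 0)"
  by (simp_all add: blk1_def blk2_def)

lemma blk_mult_entry:
  "dim_row M = p \<Longrightarrow> i < p + q \<Longrightarrow> j < dim_col M \<Longrightarrow>
    (blk1 p q * M) $$ (i, j) = (if i < p then M $$ (i, j) else 0)"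
  "dim_row M = q \<Longrightarrow> i < p + q \<Longrightarrow> j < dim_col M \<Longrightarrow>
    (blk2 p q * M) $$ (i, j) = (if i < p then 0 else M $$ (i - p, j))"
  "dim_col M = p \<Longrightarrow> j < p + q \<Longrightarrow> i < dim_row M \<Longrightarrow>
    (M * mat_adjoint (blk1 p q)) $$ (i, j) = (if j < p then M $$ (i, j) else 0)"
  "dim_col M = q \<Longrightarrow> j < p + q \<Longrightarrow> i < dim_row M \<Longrightarrow>
    (M * mat_adjoint (blk2 p q)) $$ (i, j) = (if j < p then 0 else M $$ (i, j - p))"
proof -
  have *: "(\<Sum>k<N. (if k + a = i then f k else 0)) = (if i \<ge> a \<and> i - a < N then f (i - a) else 0)"
    for N i a :: nat and f :: "nat \<Rightarrow> complex"
  proof (cases "i \<ge> a")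
    case True
    then have "(k + a = i) = (k = i - a)" for k by auto
    then show ?thesis using True by simp
  qed auto
  have **: "(a = p + k) = (k + p = a)" for a k :: nat by auto
  have cs: "cnj (if b then 1 else 0) = (if b then 1 else 0)" for b by simp
  have ml: "(if b then 1 else 0) * x = (if b then x else 0)"
      "x * (if b then 1 else 0) = (if b then x else 0)"
    for b and x :: complex by auto
  show "dim_row M = p \<Longrightarrow> i < p + q \<Longrightarrow> j < dim_col M \<Longrightarrow>
      (blk1 p q * M) $$ (i, j) = (if i < p then M $$ (i, j) else 0)"
    by (simp add: mult_entry del: index_mult_mat(1)) (simp add: blk1_def ml cong: if_cong)
  show "dim_row M = q \<Longrightarrow> i < p + q \<Longrightarrow> j < dim_col M \<Longrightarrow>
      (blk2 p q * M) $$ (i, j) = (if i < p then 0 else M $$ (i - p, j))"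
    by (simp add: mult_entry del: index_mult_mat(1)) (auto simp: blk2_def ml ** * cong: if_cong)
  show "dim_col M = p \<Longrightarrow> j < p + q \<Longrightarrow> i < dim_row M \<Longrightarrow>
      (M * mat_adjoint (blk1 p q)) $$ (i, j) = (if j < p then M $$ (i, j) else 0)"
    by (simp add: mult_entry del: index_mult_mat(1)) (simp add: blk1_def ml cs cong: if_cong)
  show "dim_col M = q \<Longrightarrow> j < p + q \<Longrightarrow> i < dim_row M \<Longrightarrow>
      (M * mat_adjoint (blk2 p q)) $$ (i, j) = (if j < p then 0 else M $$ (i, j - p))"
    by (simp add: mult_entry del: index_mult_mat(1))
        (auto simp: blk2_def ml cs ** * cong: if_cong)
qed

lemma blk_gram:
  "mat_adjoint (blk1 p q) * blk1 p q = 1\<^sub>m p" "mat_adjoint (blk2 p q) * blk2 p q = 1\<^sub>m q"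
  "mat_adjoint (blk1 p q) * blk2 p q = 0\<^sub>m p q" "mat_adjoint (blk2 p q) * blk1 p q = 0\<^sub>m q p"
proof -
  have ml: "cnj (if b then 1 else 0) * x = (if b then x else 0)" for b x by simp
  show "mat_adjoint (blk1 p q) * blk1 p q = 1\<^sub>m p" "mat_adjoint (blk2 p q) * blk2 p q = 1\<^sub>m q"
    "mat_adjoint (blk1 p q) * blk2 p q = 0\<^sub>m p q" "mat_adjoint (blk2 p q) * blk1 p q = 0\<^sub>m q p"
    by (rule eq_matI; simp add: mult_entry blk_index ml del: index_mult_mat(1))+
qed

lemma blk_sum:
  "p + q = m \<Longrightarrow> blk1 p q * mat_adjoint (blk1 p q) + blk2 p q * mat_adjoint (blk2 p q) = 1\<^sub>m m"
  by (rule eq_matI) (auto simp: blk_mult_entry blk_index simp del: index_mult_mat(1))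

lemma jmat_blk: "jmat p = blk1 p p * mat_adjoint (blk1 p p) - blk2 p p * mat_adjoint (blk2 p p)"
  by (rule eq_matI) (auto simp: jmat_def blk_mult_entry blk_index simp del: index_mult_mat(1))

lemma jmat_dims [simp]: "dim_row (jmat p) = 2 * p" "dim_col (jmat p) = 2 * p"
  by (simp_all add: jmat_blk)

text \<open>The block columns and rows in \<open>is_weyl_function\<close> are four-block matrices
  with empty blocks; this lemma and the next bring them into the matrix ring.\<close>

lemma four_block_col:
  assumes "M \<in> carrier_mat p r" "N \<in> carrier_mat q r"
  shows "four_block_mat M (0\<^sub>m p 0) N (0\<^sub>m q 0) = blk1 p q * M + blk2 p q * N"
  using assms by (intro eq_matI) (auto simp: blk_mult_entry simp del: index_mult_mat(1))

lemma four_block_row: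
  assumes "M \<in> carrier_mat r p" "N \<in> carrier_mat r q"
  shows "four_block_mat M N (0\<^sub>m 0 p) (0\<^sub>m 0 q)
      = M * mat_adjoint (blk1 p q) + N * mat_adjoint (blk2 p q)"
  using assms by (intro eq_matI) (auto simp: blk_mult_entry simp del: index_mult_mat(1))

lemma jmat_simps:
  "mat_adjoint (jmat p) = jmat p" "jmat p * jmat p = 1\<^sub>m (2 * p)"
  "jmat p * blk1 p p = blk1 p p" "jmat p * blk2 p p = - blk2 p p"
proof -
  note g = blk_gram[of p p]
  have x: "mat_adjoint (blk1 p p) * (blk1 p p * Z) = Z"
      "mat_adjoint (blk2 p p) * (blk2 p p * Z) = Z"
    "mat_adjoint (blk1 p p) * (blk2 p p * Z) = 0\<^sub>m p (dim_col Z)"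
        "mat_adjoint (blk2 p p) * (blk1 p p * Z) = 0\<^sub>m p (dim_col Z)"
    if "dim_row Z = p" for Z
    using that by (simp_all add: mult_eq_extend[OF g(1)] mult_eq_extend[OF g(2)]
        mult_eq_extend[OF g(3)] mult_eq_extend[OF g(4)] mat_ring)
  show "mat_adjoint (jmat p) = jmat p" by (simp add: jmat_blk mat_ring)
  show "jmat p * jmat p = 1\<^sub>m (2 * p)"
    unfolding blk_sum[of p p "2 * p", simplified mult_2[symmetric], OF refl, symmetric]
    by (rule eq_matI) (simp_all add: jmat_blk mat_ring x del: index_mult_mat(1))
  show "jmat p * blk1 p p = blk1 p p" "jmat p * blk2 p p = - blk2 p p"
    by (rule eq_matI; simp add: jmat_blk mat_ring g del: index_mult_mat(1))+
qed

text \<open>Gram-Schmidt for the inner product of \<open>S\<close>: the span of the last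
  \<open>n\<close> unit vectors is normalized by induction, then the first unit vector is
  orthogonalized against it and scaled.\<close>

lemma pos_def_normalize:
  assumes "pos_def_mat n S"
  shows "\<exists>T \<in> carrier_mat n n. mat_adjoint T * S * T = 1\<^sub>m n"
  using assms
proof (induction n arbitrary: S)
  case 0
  then show ?case by (intro bexI[of _ "1\<^sub>m 0"] eq_matI) (auto simp: pos_def_mat_def)
next
  case (Suc n)
  define f where "f = blk1 1 n"
  define F where "F = blk2 1 n"
  have d [simp]: "dim_row f = Suc n" "dim_col f = 1" "dim_row F = Suc n" "dim_col F = n"
    by (simp_all add: f_def F_def)
  have g: "mat_adjoint f * f = 1\<^sub>m 1" "mat_adjoint F * F = 1\<^sub>m n" "mat_adjoint f * F = 0\<^sub>m 1 n"
    unfolding f_def F_def by (rule blk_gram)+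
  have sum1: "f * mat_adjoint f + F * mat_adjoint F = 1\<^sub>m (Suc n)"
    unfolding f_def F_def by (rule blk_sum) simp
  have Sc: "S \<in> carrier_mat (Suc n) (Suc n)" and Sa: "mat_adjoint S = S"
    using Suc.prems by (auto simp: pos_def_mat_def)
  have [simp]: "dim_row S = Suc n" "dim_col S = Suc n" using Sc by auto
  define D where "D = mat_adjoint F * S * F"
  have Dc: "D \<in> carrier_mat n n" by (intro carrier_matI) (simp_all add: D_def)
  have "pos_def_mat n D"
  proof (rule pos_def_matI[OF Dc])
    show "mat_adjoint D = D" by (simp add: D_def mat_ring Sa)
    fix Z :: "complex mat" assume Z: "Z \<in> carrier_mat n 1" "col Z 0 \<noteq> 0\<^sub>v n"
    have "col (F * Z) 0 \<noteq> 0\<^sub>v (Suc n)"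
    proof
      assume "col (F * Z) 0 = 0\<^sub>v (Suc n)"
      then have "F * Z = 0\<^sub>m (Suc n) 1" using Z(1) by (intro mat_col_eqI) auto
      then have "mat_adjoint F * (F * Z) = 0\<^sub>m n 1" by (simp add: mat_ring)
      then have "Z = 0\<^sub>m n 1" using Z(1) mult_eq_extend[OF g(2), of Z] by (simp add: mat_ring)
      with Z(2) show False by simp
    qed
    then show "0 < quad D Z 0" unfolding D_def
      using quad_congruence[OF Sc, of F Z 0] pos_def_quad_pos[OF Suc.prems, of "F * Z" 0] Z(1)
          by simp
  qed
  from Suc.IH[OF this] obtain T0 where T0: "T0 \<in> carrier_mat n n"
      "mat_adjoint T0 * D * T0 = 1\<^sub>m n"
    by auto
  have [simp]: "dim_row T0 = n" "dim_col T0 = n" using T0(1) by auto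
  define Y where "Y = F * T0"
  have [simp]: "dim_row Y = Suc n" "dim_col Y = n" by (simp_all add: Y_def)
  have YSY: "mat_adjoint Y * (S * Y) = 1\<^sub>m n" using T0(2) by (simp add: Y_def D_def mat_ring)
  have YSYZ: "mat_adjoint Y * (S * (Y * Z)) = Z" if "dim_row Z = n" for Z
    using that arg_cong[OF YSY, of "\<lambda>M. M * Z"] by (simp add: mat_ring)
  \<comment> \<open>\<open>f\<close> minus its \<open>S\<close>-orthogonal projection onto the
    columns of \<open>Y\<close>. Its first coordinate remains 1, so it is nonzero and can be scaled
    to \<open>S\<close>-norm 1.\<close>
  define x where "x = f - Y * (mat_adjoint Y * (S * f))"
  have [simp]: "dim_row x = Suc n" "dim_col x = 1" by (simp_all add: x_def)
  have YSx: "mat_adjoint Y * (S * x) = 0\<^sub>m n 1"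
    by (rule eq_matI) (simp_all add: x_def mat_ring YSYZ del: index_mult_mat(1))
  have xSY: "mat_adjoint x * (S * Y) = 0\<^sub>m 1 n"
    using arg_cong[OF YSx, of mat_adjoint] by (simp add: mat_ring Sa)
  have fx: "mat_adjoint f * x = 1\<^sub>m 1"
    by (rule eq_matI) (simp_all add: x_def Y_def mat_ring g mult_eq_extend[OF g(3)]
        del: index_mult_mat(1))
  have "col x 0 \<noteq> 0\<^sub>v (Suc n)"
  proof
    assume "col x 0 = 0\<^sub>v (Suc n)"
    then have "x = 0\<^sub>m (Suc n) 1" by (intro mat_col_eqI) auto
    then have "1\<^sub>m 1 = (0\<^sub>m 1 1 :: complex mat)" using fx by (simp add: mat_ring)
    then have "1\<^sub>m 1 $$ (0, 0) = (0\<^sub>m 1 1 :: complex mat) $$ (0, 0)" by (rule arg_cong)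
    then show False by simp
  qed
  then have s0: "0 < quad S x 0" using pos_def_quad_pos[OF Suc.prems, of x 0] by simp
  define s where "s = quad S x 0"
  have "mat_adjoint (mat_adjoint x * (S * x)) = mat_adjoint x * (S * x)"
    by (simp add: mat_ring Sa)
  then have "cnj ((mat_adjoint x * (S * x)) $$ (0, 0)) = (mat_adjoint x * (S * x)) $$ (0, 0)"
    by (metis index_mat_adjoint(1,2,3) \<open>dim_col x = 1\<close> index_mult_mat(2,3) less_one)
  then have "(mat_adjoint x * (S * x)) $$ (0, 0) = complex_of_real s"
    by (simp add: s_def quad_def mat_ring complex_eq_iff del: index_mult_mat(1))
  then have xSx: "mat_adjoint x * (S * x) = complex_of_real s \<cdot>\<^sub>m 1\<^sub>m 1"
    by (intro eq_matI) (simp_all del: index_mult_mat(1))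
  define r where "r = complex_of_real (1 / sqrt s)"
  have r: "r * r * complex_of_real s = 1" "cnj r = r"
    using s0 by (simp_all add: r_def s_def flip: of_real_mult)
  \<comment> \<open>\<open>T\<close> sends the first unit vector to \<open>r\<close> times
    \<open>x\<close> and the others to the columns of \<open>Y\<close>, an
    \<open>S\<close>-orthonormal system.\<close>
  define T where "T = r \<cdot>\<^sub>m (x * mat_adjoint f) + Y * mat_adjoint F"
  have "mat_adjoint T * S * T = 1\<^sub>m (Suc n)"
  proof -
    have z: "mat_adjoint Y * (S * (x * Z)) = 0\<^sub>m n (dim_col Z)"
       "mat_adjoint x * (S * (x * Z)) = complex_of_real s \<cdot>\<^sub>m Z" if "dim_row Z = 1" for Z
      using that arg_cong[OF YSx, of "\<lambda>M. M * Z"] arg_cong[OF xSx, of "\<lambda>M. M * Z"]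
          by (simp_all add: mat_ring)
    have z': "mat_adjoint x * (S * (Y * Z)) = 0\<^sub>m 1 (dim_col Z)" if "dim_row Z = n" for Z
      using that arg_cong[OF xSY, of "\<lambda>M. M * Z"] by (simp add: mat_ring)
    show ?thesis unfolding sum1[symmetric]
      by (rule eq_matI)
        (simp_all add: T_def mat_ring z z' YSYZ r mult.assoc[symmetric] del: index_mult_mat(1))
  qed
  moreover have "T \<in> carrier_mat (Suc n) (Suc n)" by (intro carrier_matI) (simp_all add: T_def)
  ultimately show ?case by blast
qed

subsection \<open>Weyl functions of a system\<close>

text \<open>The starting vector \<open>[M; I]\<close> of the Weyl series, free of empty
  blocks.\<close>

definition blk_col :: "nat \<Rightarrow> complex mat \<Rightarrow> complex mat" where
  "blk_col p M = blk1 p p * M + blk2 p p"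

lemma blk_col_dims [simp]: "dim_row (blk_col p M) = 2 * p" "dim_col (blk_col p M) = p"
  by (simp_all add: blk_col_def)

locale dirac_system =
  fixes p n :: nat and A S0 P0 :: "complex mat"
  assumes param: "param_mats p n A S0 P0" and S0_pos: "pos_def_mat n S0"
begin

abbreviation "S \<equiv> S_seq p A S0 P0"
abbreviation "P \<equiv> Pi_seq p A P0"
abbreviation "C \<equiv> C_seq p A S0 P0"
abbreviation "W \<equiv> W_seq p A S0 P0"
abbreviation "J \<equiv> jmat p"
abbreviation "B \<equiv> minv A"

lemma A_carrier: "A \<in> carrier_mat n n" and A_det: "det A \<noteq> 0"
  and P0_carrier: "P0 \<in> carrier_mat n (2 * p)"
  and S0_carrier: "S0 \<in> carrier_mat n n"
  using param by (auto simp: param_mats_def)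

lemmas B_props = minv_props[OF A_carrier A_det]

lemma dims [simp]: "dim_row A = n" "dim_col A = n" "dim_row B = n" "dim_col B = n"
  "dim_row S0 = n" "dim_col S0 = n" "dim_row P0 = n" "dim_col P0 = 2 * p"
  using A_carrier B_props(1) P0_carrier S0_carrier by auto

lemma P_dims [simp]: "dim_row (P k) = n" "dim_col (P k) = 2 * p"
  by (induction k) simp_all

lemma S_Suc: "S (Suc k) = S k + B * S k * mat_adjoint B
    + B * P k * mat_adjoint (P k) * mat_adjoint B"
  by (simp add: minv_adjoint[OF A_carrier A_det])

lemma S_pos: "pos_def_mat n (S k)"
proof (induction k)
  case 0
  then show ?case by (simp add: S0_pos)
next
  case (Suc k)
  then show ?case unfolding S_Suc by (rule pos_def_update) simp_all
qed

lemma S_carrier: "S k \<in> carrier_mat n n" and S_adj: "mat_adjoint (S k) = S k"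
  using S_pos[of k] by (auto simp: pos_def_mat_def)

lemma S_dims [simp]: "dim_row (S k) = n" "dim_col (S k) = n"
  using S_carrier[of k] by auto

lemmas S_inv = pos_def_minv[OF S_pos] minv_props[OF S_carrier pos_def_minv(1)[OF S_pos]]

lemma R_dims [simp]: "dim_row (minv (S k)) = n" "dim_col (minv (S k)) = n"
  using S_inv(4)[of k] by auto

text \<open>The Lyapunov identity is a hypothesis here because its own induction runs through the
  locale; \<open>lyap\<close> discharges it afterwards.\<close>

lemma stepI:
  assumes "A * S k - S k * mat_adjoint A = \<i> \<cdot>\<^sub>m (P k * J * mat_adjoint (P k))"
  shows "dirac_step n (2 * p) A B (S k) (minv (S k)) (S (Suc k)) (minv (S (Suc k))) (P k) (P
      (Suc k)) J"
  by (unfold_locales)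
    (simp_all only: S_Suc[symmetric], simp_all add: B_props S_inv S_adj jmat_simps assms
      del: S_seq.simps Pi_seq.simps, simp_all)

lemma lyap: "A * S k - S k * mat_adjoint A = \<i> \<cdot>\<^sub>m (P k * J * mat_adjoint (P k))"
proof (induction k)
  case 0
  then show ?case using param by (simp add: param_mats_def)
next
  case (Suc k)
  show ?case by (rule dirac_step.lyapunov'[OF stepI[OF Suc]])
qed

lemmas step_at = stepI[OF lyap]

lemma C_eq: "dirac_step.C (2 * p) (minv (S k)) (minv (S (Suc k))) (P k) (P (Suc k)) = C k"
  unfolding dirac_step.C_def[OF step_at] C_seq_def ..

lemma C_pos: "pos_def_mat (2 * p) (C k)"
  using dirac_step.C_pos_def[OF step_at S_pos S_inv(3)] unfolding C_eq .

lemma C_carrier: "C k \<in> carrier_mat (2 * p) (2 * p)"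
  using C_pos[of k] by (auto simp: pos_def_mat_def)

lemma C_dims [simp]: "dim_row (C k) = 2 * p" "dim_col (C k) = 2 * p"
  using C_carrier[of k] by auto

lemma W_dims [simp]: "dim_row (W z k) = 2 * p" "dim_col (W z k) = 2 * p"
  by (induction k) simp_all

lemma W_Suc_mult:
  assumes [simp]: "dim_row Z = 2 * p"
  shows "W z (Suc k) * Z = W z k * Z - (\<i> / z) \<cdot>\<^sub>m (J * (C k * (W z k * Z)))"
  by (simp add: mat_ring)

section \<open>The Weyl series at a fixed point of the lower half-plane\<close>

context
  fixes z :: complex
  assumes z: "z \<in> lower_half_plane"
begin

lemma z_props: "z \<noteq> 0" "Im z < 0" "0 < (cmod z)\<^sup>2"
  using z by (auto simp: lower_half_plane_def)

lemma q_pos: "0 < qfun z"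
  using z_props by (simp add: qfun_def add_pos_pos)

text \<open>The weight absorbs the factor \<open>1 / qfun z\<close> by which the form grows in
  \<open>telescope\<close>.\<close>

definition energy :: "complex mat \<Rightarrow> nat \<Rightarrow> nat \<Rightarrow> real" where
  "energy Z i k = qfun z ^ k * quad J (W z k * Z) i"

text \<open>For \<open>Z = blk_col p f\<close> these are the real parts of the diagonal entries of
  the terms of the Weyl series.\<close>

definition dissip :: "complex mat \<Rightarrow> nat \<Rightarrow> nat \<Rightarrow> real" where
  "dissip Z i k = qfun z ^ k * quad (C k) (W z k * Z) i"

definition rate :: real where
  "rate = qfun z * (- 2 * Im z / (cmod z)\<^sup>2)"

lemma rate_pos: "0 < rate"
proof -
  have "0 < - 2 * Im z" using z_props by simp
  with q_pos z_props show ?thesis unfolding rate_def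
      by (intro mult_pos_pos[OF q_pos] divide_pos_pos)
qed

text \<open>The identity \<open>telescope\<close>, read on a diagonal entry and multiplied by the
  next power of \<open>qfun z\<close>.\<close>

lemma energy_Suc:
  assumes [simp]: "dim_row Z = 2 * p" "i < dim_col Z"
  shows "energy Z i (Suc k) = energy Z i k + rate * dissip Z i k"
proof -
  define Y where "Y = W z k * Z"
  have [simp]: "dim_row Y = 2 * p" "dim_col Y = dim_col Z" by (simp_all add: Y_def)
  have "mat_adjoint (W z (Suc k) * Z) * J * (W z (Suc k) * Z) =
      (1 + 1 / complex_of_real ((cmod z)\<^sup>2)) \<cdot>\<^sub>m (mat_adjoint Y * J * Y)
      + complex_of_real (- 2 * Im z / (cmod z)\<^sup>2) \<cdot>\<^sub>m (mat_adjoint Y * C k * Y)"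
    using dirac_step.telescope[OF step_at, of Y z _ k, unfolded C_eq,
        OF _ z_props(1) W_Suc_mult[OF assms(1), of z k, folded Y_def]]
    by simp
  then have "quad J (W z (Suc k) * Z) i
      = Re ((1 + 1 / complex_of_real ((cmod z)\<^sup>2)) * (mat_adjoint Y * J * Y) $$ (i, i))
      + (- 2 * Im z / (cmod z)\<^sup>2) * quad (C k) Y i"
    unfolding quad_def by (simp del: index_mult_mat(1) W_seq.simps)
  also have "1 + 1 / complex_of_real ((cmod z)\<^sup>2) = complex_of_real (1 / qfun z)"
    using z_props by (simp add: qfun_def field_simps)
  finally have "quad J (W z (Suc k) * Z) i = (1 / qfun z) * quad J Y i
      + (- 2 * Im z / (cmod z)\<^sup>2) * quad (C k) Y i"
    by (simp add: quad_def del: index_mult_mat(1) W_seq.simps)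
  then show ?thesis unfolding energy_def dissip_def rate_def Y_def[symmetric] power_Suc
    using q_pos by (simp only:) (simp add: right_diff_distrib)
qed

lemma dissip_nonneg:
  assumes "dim_row Z = 2 * p" "i < dim_col Z"
  shows "0 \<le> dissip Z i k"
  unfolding dissip_def using q_pos assms
  by (intro mult_nonneg_nonneg pos_def_quad_nonneg[OF C_pos]) simp_all

lemma energy_le_dissip:
  assumes "dim_row Z = 2 * p" "i < dim_col Z"
  shows "energy Z i k \<le> dissip Z i k"
  unfolding energy_def dissip_def using q_pos assms
  by (intro mult_left_mono dirac_step.quad_J_le_C[OF step_at, of k, unfolded C_eq] C_pos) simp_all

lemma energy_ge_initial:
  assumes "dim_row Z = 2 * p" "i < dim_col Z"
  shows "quad J Z i \<le> energy Z i k"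
proof (induction k)
  case 0
  then show ?case using assms by (simp add: energy_def)
next
  case (Suc k)
  have "0 \<le> rate * dissip Z i k"
    using rate_pos dissip_nonneg[OF assms] by (intro mult_nonneg_nonneg) auto
  with Suc energy_Suc[OF assms, of k] show ?case by linarith
qed

lemma dissip_sum:
  assumes "dim_row Z = 2 * p" "i < dim_col Z"
  shows "rate * (\<Sum>k<N. dissip Z i k) = energy Z i N - quad J Z i"
proof (induction N)
  case 0
  then show ?case using assms by (simp add: energy_def)
next
  case (Suc N)
  then show ?case using energy_Suc[OF assms, of N] by (simp add: distrib_left)
qed

text \<open>The energy never falls below its initial value, while it is bounded above by the terms
  of the series, which tend to zero.\<close>

lemma quad_J_nonpos_if_summable:
  assumes "dim_row Z = 2 * p" "i < dim_col Z" "summable (dissip Z i)"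
  shows "quad J Z i \<le> 0"
proof (rule LIMSEQ_le_const[OF summable_LIMSEQ_zero[OF assms(3)]])
  show "\<exists>N. \<forall>k\<ge>N. quad J Z i \<le> dissip Z i k"
    using energy_ge_initial[OF assms(1,2)] energy_le_dissip[OF assms(1,2)] order_trans by blast
qed

text \<open>By the parallelogram law for the positive forms, the terms for \<open>Z - Z'\<close> are
  at most twice the sum of the given terms.\<close>

lemma summable_dissip_diff:
  assumes "dim_row Z = 2 * p" "dim_row Z' = 2 * p" "dim_col Z' = dim_col Z" "i < dim_col Z"
    and "summable (dissip Z i)" "summable (dissip Z' i)"
  shows "summable (dissip (Z - Z') i)"
proof (rule summable_comparison_test')
  show "summable (\<lambda>k. 2 * (dissip Z i k + dissip Z' i k))"
    using assms by (intro summable_mult summable_add)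
  note [simp] = assms(1-4)
  fix k :: nat
  have "dissip (Z - Z') i k + dissip (Z + Z') i k = 2 * (dissip Z i k + dissip Z' i k)"
    by (simp add: dissip_def quad_def mat_ring algebra_simps del: index_mult_mat(1))
  moreover have "0 \<le> dissip (Z + Z') i k" "0 \<le> dissip (Z - Z') i k" by (rule dissip_nonneg; simp)+
  ultimately show "norm (dissip (Z - Z') i k) \<le> 2 * (dissip Z i k + dissip Z' i k)" by simp
qed

abbreviation "weyl_term f k \<equiv> (complex_of_real (qfun z ^ k)) \<cdot>\<^sub>m
          (four_block_mat (mat_adjoint f) (1\<^sub>m p) (0\<^sub>m 0 p) (0\<^sub>m 0 p)
           * mat_adjoint (W z k) * C k * W z k
           * four_block_mat f (0\<^sub>m p 0) (1\<^sub>m p) (0\<^sub>m p 0))"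

lemma weyl_term_eq:
  assumes f: "f \<in> carrier_mat p p"
  shows "weyl_term f k = complex_of_real (qfun z ^ k) \<cdot>\<^sub>m
    (mat_adjoint (W z k * blk_col p f) * C k * (W z k * blk_col p f))"
proof -
  have [simp]: "dim_row f = p" "dim_col f = p" using f by auto
  have "four_block_mat (mat_adjoint f) (1\<^sub>m p) (0\<^sub>m 0 p) (0\<^sub>m 0 p) = mat_adjoint (blk_col p f)"
    using f by (subst four_block_row[of _ p p]) (simp_all add: blk_col_def mat_ring)
  moreover have "four_block_mat f (0\<^sub>m p 0) (1\<^sub>m p) (0\<^sub>m p 0) = blk_col p f"
    using f by (subst four_block_col[of _ p p]) (simp_all add: blk_col_def mat_ring)
  ultimately show ?thesis by (simp add: mat_ring)
qed

text \<open>The values of \<open>dissip\<close> are the real parts of the diagonal entries; all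
  entries are dominated by them through \<open>quad_entry_bound\<close>.\<close>

lemma converges_iff:
  assumes f: "f \<in> carrier_mat p p"
  shows "mat_series_converges p p (weyl_term f) \<longleftrightarrow> (\<forall>i<p. summable (dissip (blk_col p f) i))"
proof
  assume c: "mat_series_converges p p (weyl_term f)"
  show "\<forall>i<p. summable (dissip (blk_col p f) i)"
  proof (intro allI impI)
    fix i assume i: "i < p"
    with c have "summable (\<lambda>k. weyl_term f k $$ (i, i))" by (simp add: mat_series_converges_def)
    then have "summable (\<lambda>k. Re (weyl_term f k $$ (i, i)))" by (rule summable_Re)
    moreover have "Re (weyl_term f k $$ (i, i)) = dissip (blk_col p f) i k" for k
      unfolding weyl_term_eq[OF f] dissip_def quad_def using i by (simp del: index_mult_mat(1))
    ultimately show "summable (dissip (blk_col p f) i)" by simp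
  qed
next
  assume s: "\<forall>i<p. summable (dissip (blk_col p f) i)"
  show "mat_series_converges p p (weyl_term f)"
    unfolding mat_series_converges_def
  proof (intro allI impI)
    fix i l assume il: "i < p" "l < p"
    show "summable (\<lambda>k. weyl_term f k $$ (i, l))"
    proof (rule summable_comparison_test')
      show "summable (\<lambda>k. (dissip (blk_col p f) i k + dissip (blk_col p f) l k) / 2)"
        using s il by (intro summable_divide summable_add) auto
      fix k :: nat
      let ?Y = "W z k * blk_col p f"
      have "norm (weyl_term f k $$ (i, l))
          = qfun z ^ k * cmod ((mat_adjoint ?Y * C k * ?Y) $$ (i, l))"
        unfolding weyl_term_eq[OF f] using il q_pos
            by (simp add: norm_mult norm_power del: index_mult_mat(1))
      also have "\<dots> \<le> qfun z ^ k * ((quad (C k) ?Y i + quad (C k) ?Y l) / 2)"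
        using il q_pos by (intro mult_left_mono quad_entry_bound[OF C_pos]) simp_all
      also have "\<dots> = (dissip (blk_col p f) i k + dissip (blk_col p f) l k) / 2"
        by (simp add: dissip_def algebra_simps)
      finally show "norm (weyl_term f k $$ (i, l))
          \<le> (dissip (blk_col p f) i k + dissip (blk_col p f) l k) / 2" .
    qed
  qed
qed

text \<open>The difference of the starting vectors is \<open>[f - g; 0]\<close>, where the form of
  \<open>J\<close> is the squared norm of a column of \<open>f - g\<close>. Summability along it
  forces that norm to vanish.\<close>

lemma weyl_unique:
  assumes f: "f \<in> carrier_mat p p" "mat_series_converges p p (weyl_term f)"
    and g: "g \<in> carrier_mat p p" "mat_series_converges p p (weyl_term g)"
  shows "f = g"
proof -
  have [simp]: "dim_row f = p" "dim_col f = p" "dim_row g = p" "dim_col g = p"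
      using f(1) g(1) by auto
  define D where "D = blk_col p f - blk_col p g"
  have D: "D = blk1 p p * (f - g)"
    by (rule eq_matI) (simp_all add: D_def blk_col_def mat_ring del: index_mult_mat(1))
  have [simp]: "dim_row D = 2 * p" "dim_col D = p" by (simp_all add: D_def)
  have q: "quad J D i = quad (1\<^sub>m p) (f - g) i" if "i < p" for i
  proof -
    have "J * D = D" unfolding D using mult_eq_extend[OF jmat_simps(3)[of p], of "f - g"]
      by simp
    then have "mat_adjoint D * J * D = mat_adjoint D * D" by (simp add: mat_ring)
    also have "\<dots> = mat_adjoint (f - g) * (mat_adjoint (blk1 p p) * (blk1 p p * (f - g)))"
      unfolding D by (simp add: mat_ring)
    also have "mat_adjoint (blk1 p p) * (blk1 p p * (f - g)) = f - g"
      using mult_eq_extend[OF blk_gram(1)[of p p], of "f - g"] by (simp add: mat_ring)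
    finally show ?thesis by (simp add: quad_def mat_ring del: index_mult_mat(1))
  qed
  have "f $$ (r, i) = g $$ (r, i)" if "r < p" "i < p" for r i
  proof -
    have "summable (dissip D i)" unfolding D_def
      using converges_iff[OF f(1)] converges_iff[OF g(1)] f(2) g(2) that
      by (intro summable_dissip_diff) auto
    then have "quad J D i \<le> 0" using that by (intro quad_J_nonpos_if_summable) simp_all
    then have "(\<Sum>k<p. (cmod ((f - g) $$ (k, i)))\<^sup>2) \<le> 0"
      using that by (simp add: q quad_one)
    then have "(\<Sum>k<p. (cmod ((f - g) $$ (k, i)))\<^sup>2) = 0"
      by (intro antisym sum_nonneg) auto
    then have "cmod ((f - g) $$ (r, i)) = 0" using that(1)
        by (subst (asm) sum_nonneg_eq_0_iff) auto
    then show ?thesis using that by simp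
  qed
  then show ?thesis by (intro eq_matI) auto
qed

text \<open>The hypothesis on \<open>X\<close> involves no inverse of \<open>A - z\<close>. In both
  applications \<open>X\<close> comes from the resolvent of \<open>\<theta>\<close>, which exists
  throughout the lower half-plane.\<close>

lemma weyl_converges:
  assumes X: "X \<in> carrier_mat n p"
    and eq: "A * X - z \<cdot>\<^sub>m X
        + \<i> \<cdot>\<^sub>m (P0 * blk2 p p * (mat_adjoint (P0 * blk2 p p) * (minv S0 * X)))
      = P0 * blk2 p p"
    and f: "f = (-\<i>) \<cdot>\<^sub>m (mat_adjoint (P0 * blk1 p p) * (minv S0 * X))"
  shows "mat_series_converges p p (weyl_term f)"
proof -
  have [simp]: "dim_row X = n" "dim_col X = p" using X by auto
  have [simp]: "dim_row (minv S0) = n" "dim_col (minv S0) = n" using R_dims[of 0] by auto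
  have fc: "f \<in> carrier_mat p p" by (intro carrier_matI) (simp_all add: f)
  have [simp]: "dim_row f = p" "dim_col f = p" using fc by auto
  \<comment> \<open>Forced by \<open>blk_col p f = Y 0\<close>: the lower half of the starting
    vector has to be the identity. The hypothesis on \<open>X\<close> then reads
    \<open>P0 * E = A * X - z X\<close>.\<close>
  define D where "D = 1\<^sub>m p - \<i> \<cdot>\<^sub>m (mat_adjoint (P0 * blk2 p p) * (minv S0 * X))"
  have [simp]: "dim_row D = p" "dim_col D = p" by (simp_all add: D_def)
  define E where "E = blk2 p p * D"
  have [simp]: "dim_row E = 2 * p" "dim_col E = p" by (simp_all add: E_def)
  have JE: "J * E = - E" unfolding E_def
    using mult_eq_extend[OF jmat_simps(4)[of p], of D] by (simp add: mat_ring)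
  have PE0: "P0 * E = A * X - z \<cdot>\<^sub>m X"
  proof (rule eq_matI)
    fix i j assume "i < dim_row (A * X - z \<cdot>\<^sub>m X)" "j < dim_col (A * X - z \<cdot>\<^sub>m X)"
    then show "(P0 * E) $$ (i, j) = (A * X - z \<cdot>\<^sub>m X) $$ (i, j)"
      using arg_cong[OF eq, of "\<lambda>M. M $$ (i, j)"]
      by (simp add: E_def D_def mat_ring algebra_simps del: index_mult_mat(1))
  qed simp_all
  define Xk where "Xk k = ((\<lambda>V. V - \<i> \<cdot>\<^sub>m (B * V)) ^^ k) X" for k
  have Xk_Suc: "Xk (Suc k) = Xk k - \<i> \<cdot>\<^sub>m (B * Xk k)" for k by (simp add: Xk_def)
  have Xk_dims [simp]: "dim_row (Xk k) = n" "dim_col (Xk k) = p" for k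
    by (induction k) (simp_all add: Xk_Suc, simp_all add: Xk_def)
  have PE: "P k * E = A * Xk k - z \<cdot>\<^sub>m Xk k" for k
  proof (induction k)
    case 0
    then show ?case by (simp add: PE0 Xk_def)
  next
    case (Suc k)
    show ?case by (rule dirac_step.solution_step(2)[OF step_at _ _ _ JE Suc z_props(1) refl
        Xk_Suc]) simp_all
  qed
  define Y where "Y k = E - \<i> \<cdot>\<^sub>m (J * (mat_adjoint (P k) * (minv (S k) * Xk k)))" for k
  have Y_dims [simp]: "dim_row (Y k) = 2 * p" "dim_col (Y k) = p" for k by (simp_all add: Y_def)
  have WZ: "W z k * blk_col p f = (1 + \<i> / z) ^ k \<cdot>\<^sub>m Y k" for k
  proof (induction k)
    case 0
    have JP: "J * (mat_adjoint P0 * V) = blk1 p p * (mat_adjoint (P0 * blk1 p p) * V)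
        - blk2 p p * (mat_adjoint (P0 * blk2 p p) * V)" if "dim_row V = n" for V
      using that by (simp add: jmat_blk mat_ring)
    have "blk_col p f = Y 0"
      by (rule eq_matI) (simp_all add: Y_def Xk_def JP blk_col_def f E_def D_def mat_ring
          del: index_mult_mat(1))
    then show ?case by (simp add: mat_ring)
  next
    case (Suc k)
    have s: "Y k - (\<i> / z) \<cdot>\<^sub>m (J * (C k * Y k)) = (1 + \<i> / z) \<cdot>\<^sub>m Y (Suc k)"
      unfolding Y_def[of "Suc k"]
      by (rule dirac_step.solution_step(1)[OF step_at _ _ _ JE PE z_props(1) Y_def Xk_Suc,
          unfolded C_eq]) simp_all
    have "W z (Suc k) * blk_col p f = (1 + \<i> / z) ^ k \<cdot>\<^sub>m (Y k - (\<i> / z) \<cdot>\<^sub>m (J * (C k * Y k)))"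
      unfolding W_Suc_mult[OF blk_col_dims(1)] Suc
      by (rule eq_matI) (simp_all add: mat_ring algebra_simps del: index_mult_mat(1))
    then show ?case unfolding s by (simp add: mat_ring mult.commute del: W_seq.simps)
  qed
  have neg: "quad J (Y k) i \<le> 0" if i: "i < p" for i k
  proof -
    have "mat_adjoint E * J * E = - (mat_adjoint E * E)" using JE by (simp add: mat_ring)
    also have "mat_adjoint E * E = mat_adjoint D * D"
      using mult_eq_extend[OF blk_gram(2)[of p p], of D] by (simp add: E_def mat_ring)
    finally have "mat_adjoint (Y k) * J * Y k =
        - (mat_adjoint D * D) + complex_of_real (2 * Im z) \<cdot>\<^sub>m (mat_adjoint (Xk k) * minv (S k)
            * Xk k)"
      using dirac_step.energy[OF step_at _ _ _ PE Y_def] by simp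
    then have "quad J (Y k) i = - quad (1\<^sub>m p) D i + 2 * Im z * quad (minv (S k)) (Xk k) i"
      using i by (simp add: quad_def mat_ring del: index_mult_mat(1))
    moreover have "0 \<le> quad (1\<^sub>m p) D i" using i by (intro quad_one_nonneg) simp_all
    moreover have "0 \<le> quad (minv (S k)) (Xk k) i"
      using i by (intro pos_def_quad_nonneg[OF S_inv(3)]) simp_all
    moreover have "2 * Im z * quad (minv (S k)) (Xk k) i \<le> 0"
      using z_props(2) calculation(3) by (intro mult_nonpos_nonneg[of "2 * Im z"]) simp_all
    ultimately show ?thesis by linarith
  qed
  have energy_neg: "energy (blk_col p f) i k \<le> 0" if i: "i < p" for i k
  proof -
    have "mat_adjoint (c \<cdot>\<^sub>m Y k) * J * (c \<cdot>\<^sub>m Y k)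
        = complex_of_real ((cmod c)\<^sup>2) \<cdot>\<^sub>m (mat_adjoint (Y k) * J * Y k)" for c
      unfolding complex_norm_square by (simp add: mat_ring mult.commute)
    then have "quad J (W z k * blk_col p f) i = (cmod ((1 + \<i> / z) ^ k))\<^sup>2 * quad J (Y k) i"
      unfolding WZ quad_def using i by (simp del: index_mult_mat(1))
    then show ?thesis using neg[OF i, of k] q_pos
      by (simp add: energy_def mult_nonneg_nonpos)
  qed
  show ?thesis unfolding converges_iff[OF fc]
  proof (intro allI impI)
    fix i assume i: "i < p"
    show "summable (dissip (blk_col p f) i)"
    proof (rule summableI_nonneg_bounded)
      show "0 \<le> dissip (blk_col p f) i k" for k using i by (intro dissip_nonneg) simp_all
      fix N
      \<comment> \<open>The energy at index \<open>N\<close> is nonpositive, so the telescoped sum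
        is at most minus the initial form, uniformly in \<open>N\<close>.\<close>
      have "rate * (\<Sum>k<N. dissip (blk_col p f) i k) \<le> - quad J (blk_col p f) i"
        using dissip_sum[of "blk_col p f" i N] energy_neg[OF i, of N] i by simp
      then show "(\<Sum>k<N. dissip (blk_col p f) i k) \<le> - quad J (blk_col p f) i / rate"
        using rate_pos by (simp add: field_simps)
    qed
  qed
qed

end

end

subsection \<open>Resolvents and the representation\<close>

lemma holomorphic_on_det:
  assumes "\<And>z. M z \<in> carrier_mat n n"
    and "\<And>i j. i < n \<Longrightarrow> j < n \<Longrightarrow> (\<lambda>z. M z $$ (i, j)) holomorphic_on U"
  shows "(\<lambda>z. det (M z)) holomorphic_on U"
proof -
  have "(\<lambda>z. \<Sum>\<pi>\<in>{\<pi>. \<pi> permutes {0..<n}}. signof \<pi> * (\<Prod>i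
      = 0..<n. M z $$ (i, \<pi> i))) holomorphic_on U"
    by (intro holomorphic_intros assms(2)) (auto dest: permutes_in_image)
  then show ?thesis by (simp add: det_def'[OF assms(1)])
qed

text \<open>By Cramer's formula an entry of the inverse is a cofactor divided by the determinant,
  both polynomial in the entries of \<open>M z\<close>.\<close>

lemma holomorphic_on_minv:
  assumes M: "\<And>z. M z \<in> carrier_mat n n"
    and h: "\<And>i j. i < n \<Longrightarrow> j < n \<Longrightarrow> (\<lambda>z. M z $$ (i, j)) holomorphic_on U"
    and d: "\<And>z. z \<in> U \<Longrightarrow> det (M z) \<noteq> 0" and ij: "i < n" "j < n"
  shows "(\<lambda>z. minv (M z) $$ (i, j)) holomorphic_on U"
proof -
  have dims: "dim_row (M z) = n" "dim_col (M z) = n" for z using M[of z] by auto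
  have "(\<lambda>z. det (mat_delete (M z) j i)) holomorphic_on U"
  proof (rule holomorphic_on_det[of _ "n - 1"])
    show "mat_delete (M z) j i \<in> carrier_mat (n - 1) (n - 1)" for z
        by (rule mat_delete_carrier[OF M])
    fix a b assume ab: "a < n - 1" "b < n - 1"
    then have "(\<lambda>z. mat_delete (M z) j i $$ (a, b)) =
        (\<lambda>z. M z $$ (if a < j then a else Suc a, if b < i then b else Suc b))"
      by (simp add: mat_delete_def dims)
    then show "(\<lambda>z. mat_delete (M z) j i $$ (a, b)) holomorphic_on U"
      using ab by (auto intro!: h)
  qed
  then have "(\<lambda>z. 1 / det (M z) * ((-1) ^ (j + i) * det (mat_delete (M z) j i))) holomorphic_on U"
    using d by (intro holomorphic_intros holomorphic_on_det[of M, OF M h]) auto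
  moreover have "minv (M z) $$ (i, j)
      = 1 / det (M z) * ((-1) ^ (j + i) * det (mat_delete (M z) j i))"
    if "z \<in> U" for z
    using ij by (simp add: minv_adj_mat[OF M d[OF that]] adj_mat_def cofactor_def dims)
  ultimately show ?thesis by (simp cong: holomorphic_cong)
qed

text \<open>A kernel vector \<open>Z\<close> satisfies \<open>\<theta> Z = z Z\<close>, so the form
  of \<open>\<theta>\<close> minus its adjoint at \<open>Z\<close> is \<open>2 \<i> Im z\<close>
  times the squared norm of \<open>Z\<close>. The hypothesis makes it \<open>\<i>\<close> times a
  sum of squares, against the sign of \<open>Im z\<close>.\<close>

lemma dissipative_resolvent:
  assumes th: "\<theta> \<in> carrier_mat n n" and "\<Phi> \<in> carrier_mat n p" "\<Psi> \<in> carrier_mat n p"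
    and eq: "\<theta> - mat_adjoint \<theta> = \<i> \<cdot>\<^sub>m (\<Phi> * mat_adjoint \<Phi> + \<Psi> * mat_adjoint \<Psi>)"
    and z: "Im z < 0"
  shows "det (\<theta> - z \<cdot>\<^sub>m 1\<^sub>m n) \<noteq> 0"
proof (rule det_nonzeroI)
  have [simp]: "dim_row \<theta> = n" "dim_col \<theta> = n" "dim_row \<Phi> = n" "dim_row \<Psi> = n"
    "dim_col \<Phi> = p" "dim_col \<Psi> = p" using assms by auto
  show "\<theta> - z \<cdot>\<^sub>m 1\<^sub>m n \<in> carrier_mat n n" by (intro carrier_matI) simp_all
  fix Z :: "complex mat"
  assume Z: "Z \<in> carrier_mat n 1" "col Z 0 \<noteq> 0\<^sub>v n" "(\<theta> - z \<cdot>\<^sub>m 1\<^sub>m n) * Z = 0\<^sub>m n 1"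
  have [simp]: "dim_row Z = n" "dim_col Z = 1" using Z(1) by auto
  have tZ: "\<theta> * Z = z \<cdot>\<^sub>m Z"
  proof (rule eq_matI)
    fix i j assume "i < dim_row (z \<cdot>\<^sub>m Z)" "j < dim_col (z \<cdot>\<^sub>m Z)"
    then show "(\<theta> * Z) $$ (i, j) = (z \<cdot>\<^sub>m Z) $$ (i, j)"
      using arg_cong[OF Z(3), of "\<lambda>M. M $$ (i, j)"] by (simp add: mat_ring del: index_mult_mat(1))
  qed simp_all
  have Zt: "mat_adjoint Z * mat_adjoint \<theta> = cnj z \<cdot>\<^sub>m mat_adjoint Z"
    using arg_cong[OF tZ, of mat_adjoint] by (simp add: mat_ring)
  have "mat_adjoint Z * (\<theta> - mat_adjoint \<theta>) * Z
      = z \<cdot>\<^sub>m (mat_adjoint Z * Z) - cnj z \<cdot>\<^sub>m (mat_adjoint Z * Z)"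
    using mult_eq_extend[OF Zt, of Z] by (simp add: mat_ring tZ)
  then have "(\<i> \<cdot>\<^sub>m (mat_adjoint Z * (\<Phi> * (mat_adjoint \<Phi> * Z)))
      + \<i> \<cdot>\<^sub>m (mat_adjoint Z * (\<Psi> * (mat_adjoint \<Psi> * Z)))) $$ (0, 0)
      = (z \<cdot>\<^sub>m (mat_adjoint Z * Z) - cnj z \<cdot>\<^sub>m (mat_adjoint Z * Z)) $$ (0, 0)"
    unfolding eq by (simp add: mat_ring)
  then have "\<i> * (mat_adjoint Z * (\<Phi> * (mat_adjoint \<Phi> * Z))) $$ (0, 0)
      + \<i> * (mat_adjoint Z * (\<Psi> * (mat_adjoint \<Psi> * Z))) $$ (0, 0)
      = (z - cnj z) * (mat_adjoint Z * Z) $$ (0, 0)"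
    by (simp add: left_diff_distrib del: index_mult_mat(1))
  then have "quad (1\<^sub>m p) (mat_adjoint \<Phi> * Z) 0 + quad (1\<^sub>m p) (mat_adjoint \<Psi> * Z) 0
      = 2 * Im z * quad (1\<^sub>m n) Z 0"
    by (simp add: quad_def mat_ring complex_eq_iff del: index_mult_mat(1))
  moreover have "0 \<le> quad (1\<^sub>m p) (mat_adjoint \<Phi> * Z) 0" "0 \<le> quad (1\<^sub>m p) (mat_adjoint \<Psi> * Z) 0"
    by (rule quad_one_nonneg; simp)+
  moreover have "2 * Im z * quad (1\<^sub>m n) Z 0 < 0"
    using quad_one_pos[of 0 Z n] Z(2) z by (intro mult_neg_pos[of "2 * Im z"]) simp_all
  ultimately show False by linarith
qed

text \<open>Passing from \<open>\<theta>\<close> to \<open>A\<close> changes the sign of the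
  \<open>\<Psi>\<close> term in the hypothesis, which gives the Lyapunov identity for the identity
  matrix as \<open>S0\<close>. The resolvent of \<open>\<theta>\<close> applied to
  \<open>\<Psi>\<close> is the \<open>X\<close> of \<open>weyl_converges\<close>.\<close>

lemma representation_is_weyl:
  assumes th: "\<theta> \<in> carrier_mat n n" and Phi: "\<Phi> \<in> carrier_mat n p" and Psi: "\<Psi> \<in> carrier_mat n p"
    and eq: "\<theta> - mat_adjoint \<theta> = \<i> \<cdot>\<^sub>m (\<Phi> * mat_adjoint \<Phi> + \<Psi> * mat_adjoint \<Psi>)"
    and det: "det (\<theta> - \<i> \<cdot>\<^sub>m (\<Psi> * mat_adjoint \<Psi>)) \<noteq> 0"
    and phi: "\<forall>z\<in>lower_half_plane. \<phi> z = - \<i> \<cdot>\<^sub>m (mat_adjoint \<Phi> * minv (\<theta> - z \<cdot>\<^sub>m 1\<^sub>m n) * \<Psi>)"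
    and A: "A = \<theta> - \<i> \<cdot>\<^sub>m (\<Psi> * mat_adjoint \<Psi>)"
    and P0: "P0 = four_block_mat \<Phi> \<Psi> (0\<^sub>m 0 p) (0\<^sub>m 0 p)"
  shows "param_mats p n A (1\<^sub>m n) P0"
    and "pos_def_mat (2 * p) (C_seq p A (1\<^sub>m n) P0 k)"
    and "is_weyl_function p A (1\<^sub>m n) P0 \<phi>"
proof -
  have [simp]: "dim_row \<theta> = n" "dim_col \<theta> = n" "dim_row \<Phi> = n" "dim_row \<Psi> = n"
    "dim_col \<Phi> = p" "dim_col \<Psi> = p" using assms by auto
  have P0': "P0 = \<Phi> * mat_adjoint (blk1 p p) + \<Psi> * mat_adjoint (blk2 p p)"
    unfolding P0 by (rule four_block_row[OF Phi Psi])
  have [simp]: "dim_row A = n" "dim_col A = n" "dim_row P0 = n" "dim_col P0 = 2 * p"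
    by (simp_all add: A P0')
  have Pb: "P0 * blk1 p p = \<Phi>" "P0 * blk2 p p = \<Psi>"
    by (rule eq_matI; simp add: P0' mat_ring blk_gram del: index_mult_mat(1))+
  have "P0 * jmat p * mat_adjoint P0 = (P0 * blk1 p p) * mat_adjoint (P0 * blk1 p p)
      - (P0 * blk2 p p) * mat_adjoint (P0 * blk2 p p)"
    by (simp add: jmat_blk mat_ring)
  then have PjP: "P0 * jmat p * mat_adjoint P0 = \<Phi> * mat_adjoint \<Phi> - \<Psi> * mat_adjoint \<Psi>"
    unfolding Pb .
  have lyap: "A * 1\<^sub>m n - 1\<^sub>m n * mat_adjoint A = \<i> \<cdot>\<^sub>m (P0 * jmat p * mat_adjoint P0)"
  proof (rule eq_matI)
    fix i j assume "i < dim_row (\<i> \<cdot>\<^sub>m (P0 * jmat p * mat_adjoint P0))"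
      "j < dim_col (\<i> \<cdot>\<^sub>m (P0 * jmat p * mat_adjoint P0))"
    then show "(A * 1\<^sub>m n - 1\<^sub>m n * mat_adjoint A) $$ (i, j)
        = (\<i> \<cdot>\<^sub>m (P0 * jmat p * mat_adjoint P0)) $$ (i, j)"
      unfolding PjP using arg_cong[OF eq, of "\<lambda>M. M $$ (i, j)"]
      by (simp add: A mat_ring algebra_simps del: index_mult_mat(1))
  qed simp_all
  show param: "param_mats p n A (1\<^sub>m n) P0"
    unfolding param_mats_def using det lyap
    by (auto intro!: carrier_matI simp: mat_ring A[symmetric] simp del: index_mult_mat(1))
  interpret dirac_system p n A "1\<^sub>m n" P0
    by unfold_locales (rule param pos_def_one)+
  show "pos_def_mat (2 * p) (C_seq p A (1\<^sub>m n) P0 k)" by (rule C_pos)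
  have res: "det (\<theta> - z \<cdot>\<^sub>m 1\<^sub>m n) \<noteq> 0" if "z \<in> lower_half_plane" for z
    using dissipative_resolvent[OF th Phi Psi eq] that by (simp add: lower_half_plane_def)
  have rc: "\<theta> - z \<cdot>\<^sub>m 1\<^sub>m n \<in> carrier_mat n n" for z by (intro carrier_matI) simp_all
  have minv1: "minv (1\<^sub>m n) = 1\<^sub>m n" by (rule minv_unique(2)[of _ n]) simp_all
  have phi_c: "\<phi> z \<in> carrier_mat p p" if "z \<in> lower_half_plane" for z
    using phi that by (auto intro!: carrier_matI)
  have hol: "(\<lambda>z. \<phi> z $$ (i, l)) holomorphic_on lower_half_plane" if il: "i < p" "l < p" for i l
  proof -
    have "\<phi> z $$ (i, l) = - \<i> * (\<Sum>b<n. (\<Sum>a<n. cnj (\<Phi> $$ (a, i)) * minv (\<theta>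
        - z \<cdot>\<^sub>m 1\<^sub>m n) $$ (a, b)) * \<Psi> $$ (b, l))"
      if "z \<in> lower_half_plane" for z
      using phi that il minv_props(1)[OF rc res[OF that]]
      by (simp add: mult_entry del: index_mult_mat(1))
    moreover have "(\<lambda>z. - \<i> * (\<Sum>b<n. (\<Sum>a<n. cnj (\<Phi> $$ (a, i)) * minv (\<theta>
        - z \<cdot>\<^sub>m 1\<^sub>m n) $$ (a, b)) * \<Psi> $$ (b, l)))
      holomorphic_on lower_half_plane"
      by (intro holomorphic_intros holomorphic_on_minv[OF rc] res)
          (auto intro!: holomorphic_intros)
    ultimately show ?thesis by (simp cong: holomorphic_cong)
  qed
  show "is_weyl_function p A (1\<^sub>m n) P0 \<phi>"
    unfolding is_weyl_function_def mat_holomorphic_on_def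
  proof (intro conjI ballI allI impI)
    fix z assume z: "z \<in> lower_half_plane"
    note m = minv_props[OF rc res[OF z]]
    define X where "X = minv (\<theta> - z \<cdot>\<^sub>m 1\<^sub>m n) * \<Psi>"
    have [simp]: "dim_row (minv (\<theta> - z \<cdot>\<^sub>m 1\<^sub>m n)) = n" "dim_col (minv (\<theta> - z \<cdot>\<^sub>m 1\<^sub>m n)) = n"
      using m(1) by auto
    have X: "X \<in> carrier_mat n p" by (intro carrier_matI) (simp_all add: X_def)
    then have [simp]: "dim_row X = n" "dim_col X = p" by auto
    have tX: "(\<theta> - z \<cdot>\<^sub>m 1\<^sub>m n) * X = \<Psi>"
      unfolding X_def using mult_eq_extend[OF m(2), of \<Psi>] by (simp add: mat_one_mult)
    show "mat_series_converges p p (weyl_term z (\<phi> z))"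
    proof (rule weyl_converges[OF z X])
      show "\<phi> z = - \<i> \<cdot>\<^sub>m (mat_adjoint (P0 * blk1 p p) * (minv (1\<^sub>m n) * X))"
        using phi z by (simp add: Pb minv1 X_def mat_ring)
      show "A * X - z \<cdot>\<^sub>m X
          + \<i> \<cdot>\<^sub>m (P0 * blk2 p p * (mat_adjoint (P0 * blk2 p p) * (minv (1\<^sub>m n) * X)))
          = P0 * blk2 p p"
      proof (rule eq_matI)
        fix i j assume ij: "i < dim_row (P0 * blk2 p p)" "j < dim_col (P0 * blk2 p p)"
        show "(A * X - z \<cdot>\<^sub>m X
            + \<i> \<cdot>\<^sub>m (P0 * blk2 p p * (mat_adjoint (P0 * blk2 p p) * (minv (1\<^sub>m n) * X)))) $$ (i,
            j) = (P0 * blk2 p p) $$ (i, j)"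
          unfolding Pb minv1 using ij arg_cong[OF tX, of "\<lambda>M. M $$ (i, j)"]
          by (simp add: A mat_ring algebra_simps del: index_mult_mat(1))
      qed (simp_all add: minv1)
    qed
  qed (use phi_c hol in auto)
qed

text \<open>After the change of basis \<open>weyl_converges\<close> applies to the resolvent formula
  at every point; \<open>weyl_unique\<close> then forces the given Weyl function to agree with
  it.\<close>

lemma weyl_has_representation:
  assumes "param_mats p n A S0 P0" "pos_def_mat n S0" and weyl: "is_weyl_function p A S0 P0 \<phi>"
  shows "\<exists>\<theta> \<Phi> \<Psi>. \<theta> \<in> carrier_mat n n \<and> \<Phi> \<in> carrier_mat n p \<and> \<Psi> \<in> carrier_mat n p \<and>
      \<theta> - mat_adjoint \<theta> = \<i> \<cdot>\<^sub>m (\<Phi> * mat_adjoint \<Phi> + \<Psi> * mat_adjoint \<Psi>) \<and>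
      det (\<theta> - \<i> \<cdot>\<^sub>m (\<Psi> * mat_adjoint \<Psi>)) \<noteq> 0 \<and>
      (\<forall>z\<in>lower_half_plane. \<phi> z = - \<i> \<cdot>\<^sub>m (mat_adjoint \<Phi> * minv (\<theta> - z \<cdot>\<^sub>m 1\<^sub>m n) * \<Psi>))"
proof -
  interpret dirac_system p n A S0 P0 by unfold_locales (rule assms)+
  obtain T where T: "T \<in> carrier_mat n n" "mat_adjoint T * S0 * T = 1\<^sub>m n"
    using pos_def_normalize[OF S0_pos] by auto
  have [simp]: "dim_row T = n" "dim_col T = n" using T(1) by auto
  have S0a: "mat_adjoint S0 = S0" using S0_pos by (simp add: pos_def_mat_def)
  \<comment> \<open>\<open>L\<close> is the inverse of the adjoint of \<open>T\<close>, so
    \<open>A'\<close> below is similar to \<open>A\<close>.\<close>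
  define L where "L = S0 * T"
  have [simp]: "dim_row L = n" "dim_col L = n" by (simp_all add: L_def)
  have ThL: "mat_adjoint T * L = 1\<^sub>m n" using T(2) by (simp add: L_def mat_ring)
  have LTh: "L * mat_adjoint T = 1\<^sub>m n"
    by (rule mat_mult_left_right_inverse[OF _ _ ThL]) (auto intro!: carrier_matI)
  have R: "minv S0 = T * mat_adjoint T"
    using LTh by (intro minv_unique(2)[OF S0_carrier])
        (auto intro!: carrier_matI simp: L_def mat_ring)
  define \<Phi> where "\<Phi> = mat_adjoint T * (P0 * blk1 p p)"
  define \<Psi> where "\<Psi> = mat_adjoint T * (P0 * blk2 p p)"
  define A' where "A' = mat_adjoint T * (A * L)"
  define \<theta> where "\<theta> = A' + \<i> \<cdot>\<^sub>m (\<Psi> * mat_adjoint \<Psi>)"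
  have d [simp]: "dim_row \<Phi> = n" "dim_row \<Psi> = n" "dim_col \<Phi> = p" "dim_col \<Psi> = p"
    "dim_row A' = n" "dim_col A' = n" by (simp_all add: \<Phi>_def \<Psi>_def A'_def)
  have [simp]: "dim_row \<theta> = n" "dim_col \<theta> = n" by (simp_all add: \<theta>_def)
  have th: "\<theta> \<in> carrier_mat n n" and Phi: "\<Phi> \<in> carrier_mat n p" and Psi: "\<Psi> \<in> carrier_mat n p"
    by (auto intro!: carrier_matI)
  have A'h: "A' - mat_adjoint A' = \<i> \<cdot>\<^sub>m (\<Phi> * mat_adjoint \<Phi>) - \<i> \<cdot>\<^sub>m (\<Psi> * mat_adjoint \<Psi>)"
  proof -
    have "A' - mat_adjoint A' = mat_adjoint T * ((A * S0 - S0 * mat_adjoint A) * T)"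
      by (simp add: A'_def L_def mat_ring S0a)
    also have "A * S0 - S0 * mat_adjoint A = \<i> \<cdot>\<^sub>m (P0 * jmat p * mat_adjoint P0)"
      using lyap[of 0] by simp
    finally show ?thesis by (simp add: \<Phi>_def \<Psi>_def jmat_blk mat_ring)
  qed
  have eq: "\<theta> - mat_adjoint \<theta> = \<i> \<cdot>\<^sub>m (\<Phi> * mat_adjoint \<Phi> + \<Psi> * mat_adjoint \<Psi>)"
  proof (rule eq_matI)
    let ?r = "\<i> \<cdot>\<^sub>m (\<Phi> * mat_adjoint \<Phi> + \<Psi> * mat_adjoint \<Psi>)"
    fix i j assume "i < dim_row ?r" "j < dim_col ?r"
    then show "(\<theta> - mat_adjoint \<theta>) $$ (i, j) = ?r $$ (i, j)"
      using arg_cong[OF A'h, of "\<lambda>M. M $$ (i, j)"]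
      by (simp add: \<theta>_def mat_ring algebra_simps del: index_mult_mat(1) index_mat_adjoint(1))
  qed simp_all
  have "\<theta> - \<i> \<cdot>\<^sub>m (\<Psi> * mat_adjoint \<Psi>) = A'"
    by (rule eq_matI) (simp_all add: \<theta>_def del: index_mult_mat(1))
  moreover have "det A' \<noteq> 0"
  proof (rule minv_unique(1)[of _ n])
    have "L * (mat_adjoint T * V) = V" if "dim_row V = n" for V
      using that mult_eq_extend[OF LTh, of V] by (simp add: mat_ring)
    moreover have "A * (B * V) = V" if "dim_row V = n" for V
      using that mult_eq_extend[OF B_props(2), of V] by (simp add: mat_ring)
    ultimately show "A' * (mat_adjoint T * (B * L)) = 1\<^sub>m n"
      by (simp add: A'_def mat_ring ThL)
  qed (auto intro!: carrier_matI)
  ultimately have det: "det (\<theta> - \<i> \<cdot>\<^sub>m (\<Psi> * mat_adjoint \<Psi>)) \<noteq> 0" by simp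
  have "\<phi> z = - \<i> \<cdot>\<^sub>m (mat_adjoint \<Phi> * minv (\<theta>
      - z \<cdot>\<^sub>m 1\<^sub>m n) * \<Psi>)" if z: "z \<in> lower_half_plane" for z
  proof (rule weyl_unique[OF z])
    have rc: "\<theta> - z \<cdot>\<^sub>m 1\<^sub>m n \<in> carrier_mat n n" by (intro carrier_matI) simp_all
    have rd: "det (\<theta> - z \<cdot>\<^sub>m 1\<^sub>m n) \<noteq> 0"
      using dissipative_resolvent[OF th Phi Psi eq] z by (simp add: lower_half_plane_def)
    note m = minv_props[OF rc rd]
    have [simp]: "dim_row (minv (\<theta> - z \<cdot>\<^sub>m 1\<^sub>m n)) = n" "dim_col (minv (\<theta> - z \<cdot>\<^sub>m 1\<^sub>m n)) = n"
      using m(1) by auto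
    show "- \<i> \<cdot>\<^sub>m (mat_adjoint \<Phi> * minv (\<theta> - z \<cdot>\<^sub>m 1\<^sub>m n) * \<Psi>) \<in> carrier_mat p p"
      by (intro carrier_matI) simp_all
    show "\<phi> z \<in> carrier_mat p p" "mat_series_converges p p (weyl_term z (\<phi> z))"
      using weyl z by (auto simp: is_weyl_function_def mat_holomorphic_on_def)
    define X where "X = minv (\<theta> - z \<cdot>\<^sub>m 1\<^sub>m n) * \<Psi>"
    have [simp]: "dim_row X = n" "dim_col X = p" by (simp_all add: X_def)
    have tX: "(\<theta> - z \<cdot>\<^sub>m 1\<^sub>m n) * X = \<Psi>"
      unfolding X_def using mult_eq_extend[OF m(2), of \<Psi>] by (simp add: mat_one_mult)
    have RL: "minv S0 * (L * X) = T * X"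
      using mult_eq_extend[OF ThL, of X] by (simp add: R mat_ring)
    have LT: "L * (mat_adjoint T * V) = V" if "dim_row V = n" for V
      using that mult_eq_extend[OF LTh, of V] by (simp add: mat_ring)
    \<comment> \<open>The resolvent equation multiplied by \<open>L\<close>: in the original
      coordinates it is the equation that \<open>weyl_converges\<close> requires of
      \<open>L * X\<close>.\<close>
    have tX': "A * (L * X) + \<i> \<cdot>\<^sub>m (P0 * blk2 p p * (mat_adjoint (P0 * blk2 p p) * (T * X)))
        - z \<cdot>\<^sub>m (L * X) = P0 * blk2 p p"
      using arg_cong[OF tX, of "\<lambda>M. L * M"] by (simp add: \<theta>_def A'_def \<Psi>_def mat_ring LT)
    show "mat_series_converges p p (weyl_term z (- \<i> \<cdot>\<^sub>m (mat_adjoint \<Phi> * minv (\<theta>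
        - z \<cdot>\<^sub>m 1\<^sub>m n) * \<Psi>)))"
    proof (rule weyl_converges[OF z, of "L * X"])
      show "L * X \<in> carrier_mat n p" by (intro carrier_matI) simp_all
      show "- \<i> \<cdot>\<^sub>m (mat_adjoint \<Phi> * minv (\<theta> - z \<cdot>\<^sub>m 1\<^sub>m n) * \<Psi>) =
          - \<i> \<cdot>\<^sub>m (mat_adjoint (P0 * blk1 p p) * (minv S0 * (L * X)))"
        unfolding RL by (simp add: X_def \<Phi>_def mat_ring)
      show "A * (L * X) - z \<cdot>\<^sub>m (L * X)
          + \<i> \<cdot>\<^sub>m (P0 * blk2 p p * (mat_adjoint (P0 * blk2 p p) * (minv S0 * (L * X))))
          = P0 * blk2 p p"
        unfolding RL
        by (rule trans[OF _ tX'], rule eq_matI)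
            (simp_all add: algebra_simps del: index_mult_mat(1))
    qed
  qed
  with th Phi Psi eq det show ?thesis by blast
qed

theorem theorem4p5:
  fixes p :: nat and \<phi> :: "complex \<Rightarrow> complex mat"
  assumes "1 \<le> p"
  shows "((\<exists>n A S0 Pi0. 0 < n \<and> param_mats p n A S0 Pi0 \<and> pos_def_mat n S0 \<and>
              is_weyl_function p A S0 Pi0 \<phi>)
          \<longleftrightarrow>
          (\<exists>n \<theta> \<Phi> \<Psi>. 0 < n \<and> \<theta> \<in> carrier_mat n n \<and> \<Phi> \<in> carrier_mat n p \<and>
              \<Psi> \<in> carrier_mat n p \<and>
              \<theta> - mat_adjoint \<theta> = \<i> \<cdot>\<^sub>m (\<Phi> * mat_adjoint \<Phi> + \<Psi> * mat_adjoint \<Psi>) \<and>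
              det (\<theta> - \<i> \<cdot>\<^sub>m (\<Psi> * mat_adjoint \<Psi>)) \<noteq> 0 \<and>
              (\<forall>z\<in>lower_half_plane.
                 \<phi> z = - \<i> \<cdot>\<^sub>m (mat_adjoint \<Phi> * minv (\<theta> - z \<cdot>\<^sub>m 1\<^sub>m n) * \<Psi>))))
         \<and>
         (\<forall>n \<theta> \<Phi> \<Psi>. 0 < n \<and> \<theta> \<in> carrier_mat n n \<and> \<Phi> \<in> carrier_mat n p \<and>
              \<Psi> \<in> carrier_mat n p \<and>
              \<theta> - mat_adjoint \<theta> = \<i> \<cdot>\<^sub>m (\<Phi> * mat_adjoint \<Phi> + \<Psi> * mat_adjoint \<Psi>) \<and>
              det (\<theta> - \<i> \<cdot>\<^sub>m (\<Psi> * mat_adjoint \<Psi>)) \<noteq> 0 \<and>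
              (\<forall>z\<in>lower_half_plane.
                 \<phi> z = - \<i> \<cdot>\<^sub>m (mat_adjoint \<Phi> * minv (\<theta> - z \<cdot>\<^sub>m 1\<^sub>m n) * \<Psi>))
            \<longrightarrow>
            (let A = \<theta> - \<i> \<cdot>\<^sub>m (\<Psi> * mat_adjoint \<Psi>);
                 S0 = 1\<^sub>m n;
                 Pi0 = four_block_mat \<Phi> \<Psi> (0\<^sub>m 0 p) (0\<^sub>m 0 p)
             in param_mats p n A S0 Pi0 \<and>
                (\<forall>k. pos_def_mat (2*p) (C_seq p A S0 Pi0 k)) \<and>
                is_weyl_function p A S0 Pi0 \<phi>))"
  (is "(?L \<longleftrightarrow> ?R) \<and> ?S")
proof -
  have S: ?S
    unfolding Let_def
  proof (intro allI impI, elim conjE)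
    fix n \<theta> \<Phi> \<Psi>
    let ?A = "\<theta> - \<i> \<cdot>\<^sub>m (\<Psi> * mat_adjoint \<Psi>)"
    let ?P = "four_block_mat \<Phi> \<Psi> (0\<^sub>m 0 p) (0\<^sub>m 0 p)"
    assume a: "\<theta> \<in> carrier_mat n n" "\<Phi> \<in> carrier_mat n p" "\<Psi> \<in> carrier_mat n p"
      "\<theta> - mat_adjoint \<theta> = \<i> \<cdot>\<^sub>m (\<Phi> * mat_adjoint \<Phi> + \<Psi> * mat_adjoint \<Psi>)" "det ?A \<noteq> 0"
      "\<forall>z\<in>lower_half_plane. \<phi> z = - \<i> \<cdot>\<^sub>m (mat_adjoint \<Phi> * minv (\<theta> - z \<cdot>\<^sub>m 1\<^sub>m n) * \<Psi>)"
    note r = representation_is_weyl[OF a refl refl]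
    show "param_mats p n ?A (1\<^sub>m n) ?P \<and> (\<forall>k. pos_def_mat (2*p) (C_seq p ?A (1\<^sub>m n) ?P k)) \<and>
        is_weyl_function p ?A (1\<^sub>m n) ?P \<phi>"
      by (intro conjI allI r)
  qed
  have "?L \<longleftrightarrow> ?R"
  proof
    assume ?L
    then obtain n A S0 Pi0 where n: "0 < n" and a: "param_mats p n A S0 Pi0" "pos_def_mat n S0"
      "is_weyl_function p A S0 Pi0 \<phi>" by (elim exE conjE)
    \<comment> \<open>The representation has the same size \<open>n\<close>, so positivity of
      \<open>n\<close> carries over.\<close>
    from weyl_has_representation[OF a] show ?R
      by (elim exE) (rule exI[of _ n], (rule exI)+, rule conjI[OF n])
  next
    assume ?R
    then obtain n \<theta> \<Phi> \<Psi> where n: "0 < n" and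
      a: "\<theta> \<in> carrier_mat n n" "\<Phi> \<in> carrier_mat n p" "\<Psi> \<in> carrier_mat n p"
      "\<theta> - mat_adjoint \<theta> = \<i> \<cdot>\<^sub>m (\<Phi> * mat_adjoint \<Phi> + \<Psi> * mat_adjoint \<Psi>)"
      "det (\<theta> - \<i> \<cdot>\<^sub>m (\<Psi> * mat_adjoint \<Psi>)) \<noteq> 0"
      "\<forall>z\<in>lower_half_plane. \<phi> z = - \<i> \<cdot>\<^sub>m (mat_adjoint \<Phi> * minv (\<theta> - z \<cdot>\<^sub>m 1\<^sub>m n) * \<Psi>)"
      by (elim exE conjE)
    note r = representation_is_weyl[OF a refl refl]
    show ?L by (intro exI conjI) (rule n r(1) pos_def_one r(3))+
  qed
  with S show ?thesis by (rule conjI[rotated])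
qed

end
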